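(* Let $\alpha$ be a positive real number, $\lambda$ a partition, and $x,y$ two indeterminates. Then, as formal power series in $1/x$ with coefficients polynomial in $y$, $$\frac{(x+y+1)_\lambda}{(x+y)_\lambda}\,\frac{(x)_\lambda}{(x+1)_\lambda}=\sum_{n\ge0}\Big(-\frac{y}{x^2}\Big)^n\Big(1+\frac{y+1}{x}\Big)^{-n}\sum_{p,q\ge0}\Big(\frac{-1}{x}\Big)^{p+q}\Big(1+\frac{y+1}{x}\Big)^{-q}\left(\sum_{k=0}^{\min(n,p+q)}\binom{|\lambda|+n-1}{n-k}F_{p+q,p,k}(\lambda)\right).$$
   Context: A partition $\mu=(\mu_1,\ldots,\mu_l)$ is a finite weakly decreasing sequence of positive integers; $l(\mu)=l$ is its length, $|\mu|=\sum_i\mu_i$ its weight, $m_i(\mu)$ the number of parts equal to $i$, and $z_\mu=\prod_{i\ge1} i^{m_i(\mu)}m_i(\mu)!$. A partition is identified with its diagram $\{(i,j):1\le i\le l(\mu),\,1\le j\le\mu_i\}$. Write $\binom{a}{n}=a(a-1)\cdots(a-n+1)/n!$ for $n\ge 0$; $\binom{a}{n}=0$ for $n<0$. For a cell $(i,j)\in\lambda$ the $\alpha$-content is $c_{ij}^{\alpha}=j-1-(i-1)/\alpha$. Set $(x)_\lambda=\prod_{(i,j)\in\lambda}(x+c_{ij}^\alpha)$. For $k\ge1$ put $d_k(\lambda)=\sum_{(i,j)\in\lambda}(c_{ij}^\alpha)^k$, and for a partition $\mu$ put $d_\mu(\lambda)=\prod_{i\ge1}d_i(\lambda)^{m_i(\mu)}$.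 For integers $n,p,k$ with $n\ge 1$, $k\ge1$, $0\le p\le n$ define $$\binom{n}{p}_{k}=\frac{n}{k}\sum_{r\ge0}\binom{p}{r}\binom{n-p}{r}\binom{n-r-1}{k-r-1}.$$ For a nonempty partition $\mu$ and integers $0\le p\le|\mu|$, $k\ge1$ define $$\genfrac{\langle}{\rangle}{0pt}{}{\mu}{p}_{k}=\sum_{(p_i)}\sum_{(k_i)}\prod_{i=1}^{l(\mu)}\binom{\mu_i}{p_i}_{k_i},$$ the sum being over all decompositions $p=\sum_{i}p_i$, $k=\sum_{i}k_i$ with $0\le p_i\le\mu_i$ and $k_i\ge 1$ for all $i$. For $n\ge1$, $k\ge1$, $0\le p\le n$ define $$F_{npk}(\lambda)=\sum_{|\mu|=n}\frac{1}{z_\mu}\genfrac{\langle}{\rangle}{0pt}{}{\mu}{p}_{k}\,d_\mu(\lambda)$$ (sum over partitions $\mu$ of $n$); for $k=0$, $F_{np0}(\lambda)=0$ with the only exception $F_{000}(\lambda)=1$. *)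

theory Defs
  imports "HOL-Analysis.Analysis" "HOL-Computational_Algebra.Computational_Algebra"
begin

definition is_partition :: "nat list \<Rightarrow> bool" where
  "is_partition \<mu> \<longleftrightarrow> sorted_wrt (\<ge>) \<mu> \<and> (\<forall>i\<in>set \<mu>. 0 < i)"

definition partitions_of :: "nat \<Rightarrow> nat list set" where
  "partitions_of n = {\<mu>. is_partition \<mu> \<and> sum_list \<mu> = n}"

(* Cells are numbered from 1, whereas list positions start at 0. *)
definition diagram :: "nat list \<Rightarrow> (nat \<times> nat) set" where
  "diagram \<mu> = {(i, j). 1 \<le> i \<and> i \<le> length \<mu> \<and> 1 \<le> j \<and> j \<le> \<mu> ! (i - 1)}"

(* The parts that do not occur contribute a factor 1, so the product over all i \<ge> 1
   is the product over the parts that occur; likewise in d_part below. *)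
definition z_part :: "nat list \<Rightarrow> real" where
  "z_part \<mu> = (\<Prod>i\<in>set \<mu>. real i ^ count_list \<mu> i * fact (count_list \<mu> i))"

definition ibinom :: "int \<Rightarrow> int \<Rightarrow> real" where
  "ibinom a n = (if n < 0 then 0 else real_of_int a gchoose nat n)"

definition content :: "real \<Rightarrow> nat \<Rightarrow> nat \<Rightarrow> real" where
  "content \<alpha> i j = real j - 1 - (real i - 1) / \<alpha>"

definition d_pow :: "real \<Rightarrow> nat list \<Rightarrow> nat \<Rightarrow> real" where
  "d_pow \<alpha> lam k = (\<Sum>(i, j)\<in>diagram lam. content \<alpha> i j ^ k)"

definition d_part :: "real \<Rightarrow> nat list \<Rightarrow> nat list \<Rightarrow> real" where
  "d_part \<alpha> lam \<mu> = (\<Prod>i\<in>set \<mu>. d_pow \<alpha> lam i ^ count_list \<mu> i)"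

(* The sum over r \<ge> 0 stops at p because p choose r vanishes for r > p. *)
definition binom_k :: "nat \<Rightarrow> nat \<Rightarrow> nat \<Rightarrow> real" where
  "binom_k n p k = real n / real k *
     (\<Sum>r\<le>p. ibinom (int p) (int r) * ibinom (int n - int p) (int r)
            * ibinom (int n - int r - 1) (int k - int r - 1))"

definition p_decomps :: "nat list \<Rightarrow> nat \<Rightarrow> nat list set" where
  "p_decomps \<mu> p = {ps. length ps = length \<mu> \<and> sum_list ps = p \<and> (\<forall>i<length \<mu>. ps ! i \<le> \<mu> ! i)}"

definition k_decomps :: "nat list \<Rightarrow> nat \<Rightarrow> nat list set" where
  "k_decomps \<mu> k = {ks. length ks = length \<mu> \<and> sum_list ks = k \<and> (\<forall>i<length \<mu>. 1 \<le> ks ! i)}"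

definition angle_k :: "nat list \<Rightarrow> nat \<Rightarrow> nat \<Rightarrow> real" where
  "angle_k \<mu> p k = (\<Sum>ps\<in>p_decomps \<mu> p. \<Sum>ks\<in>k_decomps \<mu> k.
     \<Prod>i<length \<mu>. binom_k (\<mu> ! i) (ps ! i) (ks ! i))"

definition F_fun :: "real \<Rightarrow> nat \<Rightarrow> nat \<Rightarrow> nat \<Rightarrow> nat list \<Rightarrow> real" where
  "F_fun \<alpha> n p k lam =
     (if k = 0 then (if n = 0 \<and> p = 0 then 1 else 0)
      else (\<Sum>\<mu>\<in>partitions_of n. 1 / z_part \<mu> * angle_k \<mu> p k * d_part \<alpha> lam \<mu>))"

(* Formal Laurent series in 1/x (the series variable fls_X stands for 1/x) over the field
   of rational functions in y. This field contains both the rational functions in x and y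
   (expanded at x = infinity) and the ring of formal power series in 1/x with coefficients
   polynomial in y. *)
type_synonym xy_series = "real poly fract fls"

definition const_xy :: "real \<Rightarrow> xy_series" where
  "const_xy a = fls_const (to_fract [:a:])"

definition x_xy :: xy_series where
  "x_xy = fls_X_inv"

definition y_xy :: xy_series where
  "y_xy = fls_const (to_fract [:0, 1:])"

definition poly_coeff_series :: "xy_series set" where
  "poly_coeff_series = {f. (\<forall>m<0. fls_nth f m = 0) \<and> (\<forall>m. fls_nth f m \<in> range to_fract)}"

definition rising :: "real \<Rightarrow> xy_series \<Rightarrow> nat list \<Rightarrow> xy_series" where
  "rising \<alpha> u lam = (\<Prod>(i, j)\<in>diagram lam. u + const_xy (content \<alpha> i j))"

lemma finite_lists_sum: "finite {xs :: nat list. length xs = l \<and> sum_list xs = n}"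
  by (rule finite_subset[OF _ finite_lists_length_eq[of "{..n}" l]])
     (auto intro: member_le_sum_list)

lemma finite_p_decomps: "finite (p_decomps \<mu> p)"
  by (rule finite_subset[OF _ finite_lists_sum[of "length \<mu>" p]]) (auto simp: p_decomps_def)

lemma finite_k_decomps: "finite (k_decomps \<mu> k)"
  by (rule finite_subset[OF _ finite_lists_sum[of "length \<mu>" k]]) (auto simp: k_decomps_def)

lemma length_le_sum_list: "\<forall>i\<in>set xs. 0 < i \<Longrightarrow> length xs \<le> sum_list (xs :: nat list)"
  by (induction xs) auto

lemma finite_partitions_of: "finite (partitions_of n)"
  by (rule finite_subset[OF _ finite_lists_length_le[of "{..n}" n]])
     (auto simp: partitions_of_def is_partition_def intro: member_le_sum_list length_le_sum_list)

lemma finite_diagram: "finite (diagram \<mu>)"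
proof (rule finite_subset)
  have "j \<le> sum_list \<mu>" if "1 \<le> i" "i \<le> length \<mu>" "j \<le> \<mu> ! (i - 1)" for i j
    using that by (intro order_trans[OF that(3)] member_le_sum_list) auto
  then show "diagram \<mu> \<subseteq> {..length \<mu>} \<times> {..sum_list \<mu>}"
    by (auto simp: diagram_def)
qed simp

end

theory Submission
  imports Defs
begin

text \<open>
Put \<open>u = -1/x\<close>, \<open>v = -1/(x+y+1)\<close> and \<open>t = -y/(x(x+y+1))\<close>. Then the term of the right-hand
side with indices \<open>n\<close>, \<open>p\<close>, \<open>q\<close> is a real number times \<open>t\<^sup>n u\<^sup>p v\<^sup>q\<close>, and the
left-hand side is the product of \<open>D / (D - t)\<close>, with \<open>D = (1 - u c) (1 - v c)\<close>, over the contents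
\<open>c\<close> of the cells of the diagram, \<open>N\<close> in number. So the claim is an identity between power series in
\<open>u\<close>, \<open>v\<close>, \<open>t\<close>.

On the right-hand side the sum over \<open>n\<close> is a negative binomial series: with \<open>z = t / (1 - t)\<close> it replaces
\<open>binom(N + n - 1, n - k) t\<^sup>n\<close> by \<open>(1 - t)\<^bsup>-N\<^esup> z\<^sup>k\<close>. On the left-hand side,
\<open>D / (D - t) = (1 - t)\<^sup>-\<^sup>1 D / ((1 + z) D - z)\<close>. Hence it remains to show that
\<open>\<Sum> F\<^sub>n\<^sub>p\<^sub>k u\<^sup>p v\<^bsup>n-p\<^esup> z\<^sup>k\<close> is the product of the quotients
\<open>D / ((1 + z) D - z)\<close>; note that such a quotient is \<open>1 / (1 - z w)\<close> with \<open>w = 1/D - 1\<close>.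

The coefficients of \<open>w\<^sup>k\<close> are, up to the factor \<open>n / k\<close>, the numbers \<open>binom_k\<close>
(\<open>homog_series_excess_coeff\<close>). Therefore \<open>\<Sum> binom_k n p k u\<^sup>p v\<^bsup>n-p\<^esup> z\<^sup>k / n\<close>
is \<open>\<Sum> z\<^sup>k w\<^sup>k / k = - log (1 - z w)\<close> (\<open>binom_k_sum_series\<close>, in differentiated form). Replacing
\<open>u\<close>, \<open>v\<close> by \<open>u c\<close>, \<open>v c\<close> and adding over the cells introduces the power sums \<open>d_pow\<close>, and the
exponential formula \<open>exp (\<Sum> a\<^sub>r / r) = \<Sum> a\<^sub>\<mu> / z\<^sub>\<mu>\<close> turns the sum of logarithms into the sum over
partitions that defines \<open>F_fun\<close> (\<open>cycle_sum_cells\<close>, \<open>F_fun_series\<close>). All formal arguments are made with a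
variable that marks the total degree in \<open>u\<close> and \<open>v\<close>; at the end it is set to 1, which is possible because
\<open>u\<close>, \<open>v\<close>, \<open>t\<close> are divisible by \<open>1/x\<close> (\<open>cell_product_expansion\<close>).
\<close>

unbundle no vec_syntax
unbundle Formal_Power_Series.fps_syntax and Formal_Laurent_Series.fps_syntax

section \<open>Powers of a product of two geometric series\<close>

text \<open>The powers of \<open>w = 1/D - 1\<close>, where \<open>D = (1 - u) (1 - v)\<close>, are obtained from
\<open>1 / ((1 + s) D - s) = \<Sum>k. s\<^sup>k w\<^sup>k / D\<close>. For fixed \<open>s\<close> the coefficient of
\<open>u\<^sup>p v\<^sup>q\<close> in this function is \<open>pair_sum s p q\<close>. Since \<open>w\<^sup>k / D = w\<^sup>k + w\<^bsup>k+1\<^esup>\<close>,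
passing to \<open>w\<^sup>k\<close> amounts to a division by \<open>1 + s\<close>, which yields \<open>reduced_pair_sum\<close>.\<close>
definition pair_sum :: "'a::comm_ring_1 \<Rightarrow> nat \<Rightarrow> nat \<Rightarrow> 'a" where
  "pair_sum s p q = (\<Sum>r\<le>p. of_nat ((p choose r) * (q choose r)) * s ^ r * (1 + s) ^ (p + q - r))"

definition reduced_pair_sum :: "'a::comm_ring_1 \<Rightarrow> nat \<Rightarrow> nat \<Rightarrow> 'a" where
  "reduced_pair_sum s p q = (\<Sum>r\<le>p. of_nat ((p choose r) * (q choose r)) * s ^ r * (1 + s) ^ (p + q - r - 1))"

lemma pair_sum_eq_reduced_pair_sum:
  assumes "p + q > 0"
  shows "pair_sum s p q = (1 + s) * reduced_pair_sum s p q"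
  unfolding pair_sum_def reduced_pair_sum_def sum_distrib_left
proof (rule sum.cong)
  fix r assume "r \<in> {..p}"
  show "of_nat ((p choose r) * (q choose r)) * s ^ r * (1 + s) ^ (p + q - r) =
        (1 + s) * (of_nat ((p choose r) * (q choose r)) * s ^ r * (1 + s) ^ (p + q - r - 1))"
  proof (cases "r \<le> p \<and> r \<le> q")
    case True
    then have "p + q - r = Suc (p + q - r - 1)" using assms by linarith
    then have "(1 + s) ^ (p + q - r) = (1 + s) * (1 + s) ^ (p + q - r - 1)" by (metis power_Suc)
    then show ?thesis by (simp add: algebra_simps)
  next
    case False
    then have "(p choose r) * (q choose r) = 0" by auto
    then show ?thesis by (metis mult_zero_left mult_zero_right of_nat_0)
  qed
qed simp

text \<open>Pascal's rule in both variables, multiplied out, gives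
\<open>C(p+1,r) C(q+1,r) = C(p,r) C(q+1,r) + C(p+1,r) C(q,r) - C(p,r) C(q,r) + C(p,r-1) C(q,r-1)\<close>.
Summation over \<open>r\<close> turns the last two terms into \<open>(s - (1 + s))\<close> times
\<open>pair_sum s p q\<close>, that is, into \<open>- pair_sum s p q\<close>.\<close>
lemma reduced_pair_sum_rec:
  "reduced_pair_sum s (Suc p) (Suc q) = pair_sum s p (Suc q) + pair_sum s (Suc p) q - pair_sum s p q"
proof -
  define a where "a = 1 + s"
  define B where "B p q r = (of_nat ((p choose r) * (q choose r)) :: 'a)" for p q r
  have pascal: "B (Suc p) (Suc q) r = B p (Suc q) r + B (Suc p) q r - B p q r
      + (if r = 0 then 0 else B p q (r - 1))" for r
    by (cases r) (simp_all add: B_def algebra_simps)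
  let ?m = "p + q + 1"
  have ext: "(\<Sum>r\<le>Suc p. B p q' r * s ^ r * a ^ (f r)) = (\<Sum>r\<le>p. B p q' r * s ^ r * a ^ (f r))"
    for q' and f :: "nat \<Rightarrow> nat"
    by (simp add: B_def binomial_eq_0)
  have "reduced_pair_sum s (Suc p) (Suc q) = (\<Sum>r\<le>Suc p. B (Suc p) (Suc q) r * s ^ r * a ^ (?m - r))"
    by (simp add: reduced_pair_sum_def B_def a_def)
  also have "\<dots> = (\<Sum>r\<le>Suc p. B p (Suc q) r * s ^ r * a ^ (?m - r))
      + (\<Sum>r\<le>Suc p. B (Suc p) q r * s ^ r * a ^ (?m - r))
      - (\<Sum>r\<le>Suc p. B p q r * s ^ r * a ^ (?m - r))
      + (\<Sum>r\<le>Suc p. (if r = 0 then 0 else B p q (r - 1)) * s ^ r * a ^ (?m - r))"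
    by (simp only: pascal ring_distribs sum.distrib sum_subtractf)
  also have "(\<Sum>r\<le>Suc p. B p (Suc q) r * s ^ r * a ^ (?m - r)) = pair_sum s p (Suc q)"
    unfolding ext by (simp add: pair_sum_def B_def a_def)
  also have "(\<Sum>r\<le>Suc p. B (Suc p) q r * s ^ r * a ^ (?m - r)) = pair_sum s (Suc p) q"
    by (simp add: pair_sum_def B_def a_def)
  also have "(\<Sum>r\<le>Suc p. B p q r * s ^ r * a ^ (?m - r)) = a * pair_sum s p q"
    unfolding ext pair_sum_def sum_distrib_left
    by (rule sum.cong) (simp_all add: B_def a_def Suc_diff_le algebra_simps)
  also have "(\<Sum>r\<le>Suc p. (if r = 0 then 0 else B p q (r - 1)) * s ^ r * a ^ (?m - r))
      = s * pair_sum s p q"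
    unfolding sum.atMost_Suc_shift pair_sum_def sum_distrib_left
    by (simp add: B_def a_def algebra_simps)
  finally show ?thesis by (simp add: a_def algebra_simps)
qed

lemma pair_sum_0 [simp]: "pair_sum s 0 q = (1 + s) ^ q" "pair_sum s p 0 = (1 + s) ^ p"
proof -
  show "pair_sum s 0 q = (1 + s) ^ q" by (simp add: pair_sum_def)
  have "pair_sum s p 0 = (\<Sum>r\<in>{0}. of_nat ((p choose r) * (0 choose r)) * s ^ r * (1 + s) ^ (p + 0 - r))"
    unfolding pair_sum_def by (rule sum.mono_neutral_right) (auto simp: binomial_eq_0)
  then show "pair_sum s p 0 = (1 + s) ^ p" by simp
qed

lemma reduced_pair_sum_0 [simp]: "reduced_pair_sum s 0 q = (1 + s) ^ (q - 1)" "reduced_pair_sum s p 0 = (1 + s) ^ (p - 1)"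
proof -
  show "reduced_pair_sum s 0 q = (1 + s) ^ (q - 1)" by (simp add: reduced_pair_sum_def)
  have "reduced_pair_sum s p 0 = (\<Sum>r\<in>{0}. of_nat ((p choose r) * (0 choose r)) * s ^ r * (1 + s) ^ (p + 0 - r - 1))"
    unfolding reduced_pair_sum_def by (rule sum.mono_neutral_right) (auto simp: binomial_eq_0)
  then show "reduced_pair_sum s p 0 = (1 + s) ^ (p - 1)" by simp
qed

text \<open>The coefficient of \<open>u\<^sup>p v\<^sup>q\<close> in \<open>(1 / ((1 - u) (1 - v)) - 1)\<^sup>k\<close>,
as \<open>homog_series_excess_coeff\<close> below shows. The case \<open>p = q = 0\<close> is separate because there
the exponent \<open>p + q - r - 1\<close> of \<open>reduced_pair_sum\<close> would be \<open>-1\<close>.\<close>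
definition excess_coeff :: "nat \<Rightarrow> nat \<Rightarrow> nat \<Rightarrow> real" where
  "excess_coeff k p q = (if k = 0 then of_bool (p = 0 \<and> q = 0)
     else if p = 0 \<and> q = 0 then 0 else coeff (reduced_pair_sum [:0, 1:] p q) (k - 1))"

lemma excess_coeff_add:
  "excess_coeff (Suc k) p q + excess_coeff k p q = coeff (pair_sum [:0, 1:] p q) k"
proof (cases "p + q > 0")
  case True
  have "(1 + [:0, 1:]) * reduced_pair_sum [:0, 1:] p q = reduced_pair_sum [:0, 1:] p q + pCons 0 (reduced_pair_sum [:0, 1 :: real:] p q)"
    by (simp add: algebra_simps)
  with True show ?thesis
    by (subst pair_sum_eq_reduced_pair_sum) (auto simp: excess_coeff_def coeff_pCons split: nat.splits)
qed (auto simp: excess_coeff_def)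

text \<open>With \<open>w = 1 / ((1 - u) (1 - v)) - 1\<close> this is the coefficient form of
\<open>w\<^bsup>k+1\<^esup> = (u + v - u v) (w\<^bsup>k+1\<^esup> + w\<^sup>k)\<close>.\<close>
lemma excess_coeff_rec:
  fixes k :: nat
  defines "h \<equiv> (\<lambda>p q. excess_coeff (Suc k) p q + excess_coeff k p q)"
  shows "excess_coeff (Suc k) p q = (if p = 0 then 0 else h (p - 1) q) + (if q = 0 then 0 else h p (q - 1))
     - (if p = 0 \<or> q = 0 then 0 else h (p - 1) (q - 1))"
  unfolding h_def excess_coeff_add
  by (cases p; cases q) (simp_all add: excess_coeff_def reduced_pair_sum_rec)

text \<open>Extracting the power \<open>s\<^sup>j\<close> from the summands above produces the third binomial
coefficient in the definition of \<open>binom_k\<close>.\<close>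
lemma coeff_monom_linear_power:
  "coeff ([:0, 1:] ^ r * (1 + [:0, 1:]) ^ m) j = (if j < r then 0 else of_nat (m choose (j - r)) :: real)"
proof -
  have "coeff ((1 + [:0, 1 :: real:]) ^ m) i = of_nat (m choose i)" for i
    using coeff_linear_poly_power[of i m 1 1]
    by (cases "i \<le> m") (simp_all add: one_pCons coeff_eq_0 degree_linear_power le_less_trans binomial_eq_0)
  moreover have "[:0, 1 :: real:] ^ r = monom 1 r" by (simp add: monom_altdef)
  ultimately show ?thesis by (simp add: coeff_monom_mult)
qed

lemma ibinom_of_nat: "ibinom (int a) (int b) = real (a choose b)"
  by (simp add: ibinom_def binomial_gbinomial)

lemma binom_k_eq_excess_coeff:
  assumes "p \<le> n" "n > 0" "k > 0"
  shows "binom_k n p k = real n / real k * excess_coeff k p (n - p)"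
proof -
  have summand: "ibinom (int p) (int r) * ibinom (int n - int p) (int r) * ibinom (int n - int r - 1) (int k - int r - 1)
     = coeff (of_nat ((p choose r) * ((n - p) choose r)) * [:0, 1:] ^ r * (1 + [:0, 1:]) ^ (p + (n - p) - r - 1)) (k - 1)"
    (is "_ = ?rhs") for r
  proof -
    have rhs: "?rhs = real ((p choose r) * ((n - p) choose r)) *
        (if k - 1 < r then 0 else real ((n - r - 1) choose (k - 1 - r)))"
      using assms(1) unfolding mult.assoc of_nat_mult_conv_smult
      by (simp add: of_nat_poly coeff_monom_linear_power del: mult_pCons_left)
    show ?thesis
    proof (cases "r \<le> p \<and> r \<le> n - p")
      case True
      have 1: "ibinom (int p) (int r) = real (p choose r)"
        by (rule ibinom_of_nat)
      have 2: "ibinom (int n - int p) (int r) = real ((n - p) choose r)"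
        using assms(1) ibinom_of_nat[of "n - p" r] by (simp add: of_nat_diff)
      have 3: "ibinom (int n - int r - 1) (int k - int r - 1) =
        (if k - 1 < r then 0 else real ((n - r - 1) choose (k - 1 - r)))"
      proof (cases "k - 1 < r")
        case False
        have "int n - int r - 1 = int (n - r - 1)" "int k - int r - 1 = int (k - 1 - r)"
          using True assms False by linarith+
        then show ?thesis using False by (simp only: ibinom_of_nat if_False)
      qed (use assms in \<open>simp add: ibinom_def\<close>)
      show ?thesis unfolding 1 2 3 rhs by simp
    next
      case False
      then have "ibinom (int p) (int r) * ibinom (int n - int p) (int r) = 0"
        using assms(1) ibinom_of_nat[of p r] ibinom_of_nat[of "n - p" r] by (auto simp: of_nat_diff)
      moreover have "(p choose r) * ((n - p) choose r) = 0" using False by auto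
      ultimately show ?thesis unfolding rhs by (metis mult_zero_left of_nat_0)
    qed
  qed
  show ?thesis
    using assms unfolding binom_k_def summand by (auto simp: excess_coeff_def reduced_pair_sum_def coeff_sum)
qed

text \<open>The numbers \<open>F_fun\<close> and the contents are real, whereas the series live over a field of
Laurent series; \<open>\<rho>\<close> embeds the reals as constants.\<close>
locale real_scalars =
  fixes \<rho> :: "real \<Rightarrow> 'a::field_char_0"
  assumes add: "\<rho> (a + b) = \<rho> a + \<rho> b"
    and mult: "\<rho> (a * b) = \<rho> a * \<rho> b"
    and one: "\<rho> 1 = 1"
begin

lemma zero [simp]: "\<rho> 0 = 0"
  using add[of 0 0] by simp

lemma minus: "\<rho> (- a) = - \<rho> a"
  using add[of a "- a"] by (simp add: eq_neg_iff_add_eq_0 add.commute)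

lemma diff: "\<rho> (a - b) = \<rho> a - \<rho> b"
  using add[of a "- b"] by (simp add: minus)

lemma of_nat [simp]: "\<rho> (of_nat n) = of_nat n"
  by (induction n) (simp_all add: add one)

lemma power: "\<rho> (a ^ n) = \<rho> a ^ n"
  by (induction n) (simp_all add: mult one)

lemma sum: "\<rho> (sum f I) = (\<Sum>i\<in>I. \<rho> (f i))"
  by (induction I rule: infinite_finite_induct) (simp_all add: add)

lemma divide: "\<rho> (a / b) = \<rho> a / \<rho> b"
proof (cases "b = 0")
  case False
  then have "\<rho> (a / b) * \<rho> b = \<rho> a" "\<rho> (1 / b) * \<rho> b = 1"
    by (simp_all flip: mult add: one)
  then show ?thesis by (metis mult_zero_right nonzero_eq_divide_eq zero_neq_one)
qed simp

text \<open>A double series \<open>\<Sum> f p q u\<^sup>p v\<^sup>q\<close> in two scalars \<open>u\<close>, \<open>v\<close>, made formal by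
a variable that marks the total degree \<open>p + q\<close>.\<close>
definition homog_series :: "'a \<Rightarrow> 'a \<Rightarrow> (nat \<Rightarrow> nat \<Rightarrow> real) \<Rightarrow> 'a fps" where
  "homog_series u v f = Abs_fps (\<lambda>n. \<Sum>p\<le>n. \<rho> (f p (n - p)) * u ^ p * v ^ (n - p))"

lemma homog_series_add:
  "homog_series u v (\<lambda>p q. f p q + g p q) = homog_series u v f + homog_series u v g"
  by (rule fps_ext) (simp add: homog_series_def add algebra_simps sum.distrib)

lemma homog_series_diff:
  "homog_series u v (\<lambda>p q. f p q - g p q) = homog_series u v f - homog_series u v g"
  by (rule fps_ext) (simp add: homog_series_def diff algebra_simps sum_subtractf)

lemma homog_series_shift_fst:
  "homog_series u v (\<lambda>p q. if p = 0 then 0 else f (p - 1) q) = fps_const u * fps_X * homog_series u v f"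
proof (rule fps_ext)
  fix n
  show "homog_series u v (\<lambda>p q. if p = 0 then 0 else f (p - 1) q) $ n
      = (fps_const u * fps_X * homog_series u v f) $ n"
  proof (cases n)
    case (Suc m)
    then show ?thesis
      by (simp add: homog_series_def mult.assoc sum.atMost_Suc_shift sum_distrib_left del: sum.atMost_Suc)
        (simp add: algebra_simps)
  qed (simp add: homog_series_def mult.assoc)
qed

lemma homog_series_shift_snd:
  "homog_series u v (\<lambda>p q. if q = 0 then 0 else f p (q - 1)) = fps_const v * fps_X * homog_series u v f"
proof (rule fps_ext)
  fix n
  show "homog_series u v (\<lambda>p q. if q = 0 then 0 else f p (q - 1)) $ n
      = (fps_const v * fps_X * homog_series u v f) $ n"
  proof (cases n)
    case (Suc m)
    have "(\<Sum>p\<le>m. \<rho> (if Suc m - p = 0 then 0 else f p (Suc m - p - 1)) * u ^ p * v ^ (Suc m - p))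
        = v * (\<Sum>p\<le>m. \<rho> (f p (m - p)) * u ^ p * v ^ (m - p))"
      unfolding sum_distrib_left by (rule sum.cong) (auto simp: Suc_diff_le)
    with Suc show ?thesis
      by (simp add: homog_series_def mult.assoc)
  qed (simp add: homog_series_def mult.assoc)
qed

definition cell_poly :: "'a \<Rightarrow> 'a \<Rightarrow> 'a fps" where
  "cell_poly u v = (1 - fps_const u * fps_X) * (1 - fps_const v * fps_X)"

lemma cell_poly_nth_0 [simp]: "cell_poly u v $ 0 = 1"
  by (simp add: cell_poly_def)

text \<open>Multiplication by \<open>u\<close> or \<open>v\<close> shifts the coefficients, so the recurrence for the
coefficients is the equation \<open>D W\<^bsub>k+1\<^esub> = (1 - D) W\<^sub>k\<close> with \<open>D = cell_poly u v\<close>.\<close>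
lemma homog_series_excess_coeff:
  "homog_series u v (excess_coeff k) = (inverse (cell_poly u v) - 1) ^ k"
proof (induction k)
  case 0
  show ?case
  proof (rule fps_ext)
    fix n
    have "(\<Sum>p\<le>n. \<rho> (excess_coeff 0 p (n - p)) * u ^ p * v ^ (n - p))
       = (\<Sum>p\<in>{0}. \<rho> (excess_coeff 0 p (n - p)) * u ^ p * v ^ (n - p))"
      by (rule sum.mono_neutral_right) (auto simp: excess_coeff_def)
    then show "homog_series u v (excess_coeff 0) $ n = ((inverse (cell_poly u v) - 1) ^ 0) $ n"
      by (simp add: homog_series_def excess_coeff_def one)
  qed
next
  case (Suc k)
  define D where "D = cell_poly u v"
  define W where "W k = homog_series u v (excess_coeff k)" for k
  define h where "h = (\<lambda>p q. excess_coeff (Suc k) p q + excess_coeff k p q)"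
  define S1 S2 where "S1 f = (\<lambda>p q. if p = 0 then 0 else f (p - 1) q)"
    and "S2 f = (\<lambda>p q. if q = 0 then 0 else f p (q - 1))" for f :: "nat \<Rightarrow> nat \<Rightarrow> real"
  have inv: "inverse D * D = 1" by (rule inverse_mult_eq_1) (simp add: D_def)
  have shift: "homog_series u v (S1 f) = fps_const u * fps_X * homog_series u v f"
      "homog_series u v (S2 f) = fps_const v * fps_X * homog_series u v f" for f
    unfolding S1_def S2_def by (rule homog_series_shift_fst homog_series_shift_snd)+
  have H: "homog_series u v h = W (Suc k) + W k"
    by (simp add: h_def W_def homog_series_add)
  have "excess_coeff (Suc k) = (\<lambda>p q. (S1 h p q + S2 h p q) - S1 (S2 h) p q)"
    by (intro ext) (simp add: excess_coeff_rec h_def S1_def S2_def)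
  then have "W (Suc k) = homog_series u v (\<lambda>p q. (S1 h p q + S2 h p q) - S1 (S2 h) p q)"
    unfolding W_def by metis
  also have "\<dots> = (fps_const u * fps_X + fps_const v * fps_X - fps_const u * fps_X * (fps_const v * fps_X))
      * homog_series u v h"
    unfolding homog_series_diff homog_series_add shift by (simp add: algebra_simps)
  also have "\<dots> = (1 - D) * (W (Suc k) + W k)"
    unfolding H D_def cell_poly_def by (simp add: algebra_simps)
  finally have "D * W (Suc k) = (1 - D) * W k"
    by (simp add: algebra_simps)
  then have "inverse D * (D * W (Suc k)) = inverse D * ((1 - D) * W k)"
    by simp
  then have "inverse D * D * W (Suc k) = (inverse D - inverse D * D) * W k"
    by (simp add: algebra_simps)
  then have "W (Suc k) = (inverse D - 1) * W k" unfolding inv by simp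
  with Suc show ?case by (simp add: W_def D_def)
qed

text \<open>The factor by which a part \<open>n\<close> of a partition enters the generating function of \<open>angle_k\<close>.
The sum over \<open>k\<close> may stop at \<open>n\<close> because \<open>binom_k n p k\<close> vanishes beyond.\<close>
definition binom_k_sum :: "'a \<Rightarrow> 'a \<Rightarrow> 'a \<Rightarrow> nat \<Rightarrow> 'a" where
  "binom_k_sum u v z n = (\<Sum>p\<le>n. \<Sum>k=1..n. \<rho> (binom_k n p k) * u ^ p * v ^ (n - p) * z ^ k)"

lemma binom_k_sum_eq_nth:
  "binom_k_sum u v z n = (\<Sum>k=1..n. z ^ k * \<rho> (real n / real k) * ((inverse (cell_poly u v) - 1) ^ k) $ n)"
proof (cases "n = 0")
  case False
  have "binom_k_sum u v z n = (\<Sum>k=1..n. \<Sum>p\<le>n. \<rho> (binom_k n p k) * u ^ p * v ^ (n - p) * z ^ k)"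
    unfolding binom_k_sum_def by (rule sum.swap)
  also have "\<dots> = (\<Sum>k=1..n. z ^ k * \<rho> (real n / real k) * (homog_series u v (excess_coeff k)) $ n)"
  proof (rule sum.cong)
    fix k assume "k \<in> {1..n}"
    then have "\<rho> (binom_k n p k) = \<rho> (real n / real k) * \<rho> (excess_coeff k p (n - p))" if "p \<le> n" for p
      using that False by (simp add: binom_k_eq_excess_coeff flip: mult)
    then show "(\<Sum>p\<le>n. \<rho> (binom_k n p k) * u ^ p * v ^ (n - p) * z ^ k)
       = z ^ k * \<rho> (real n / real k) * (homog_series u v (excess_coeff k)) $ n"
      by (simp add: homog_series_def sum_distrib_left algebra_simps)
  qed simp
  finally show ?thesis by (simp add: homog_series_excess_coeff)
qed (simp add: binom_k_sum_def)

text \<open>The factor \<open>n / k\<close> in \<open>binom_k\<close> is what makes this series a logarithmic derivative: writing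
\<open>w = 1/D - 1\<close>, the coefficients of \<open>n / k\<close> times \<open>w\<^sup>k\<close> are those of
\<open>X w' w\<^bsup>k-1\<^esup>\<close>, and the sum over \<open>k\<close> is the geometric series \<open>z X w' / (1 - z w)\<close>.\<close>
lemma binom_k_sum_series:
  fixes u v z :: 'a
  defines "D \<equiv> cell_poly u v"
  shows "Abs_fps (binom_k_sum u v z) * (D * (fps_const (1 + z) * D - fps_const z))
    = - fps_const z * fps_X * fps_deriv D"
proof -
  define w where "w = inverse D - 1"
  define g where "g = fps_const z * fps_X * fps_deriv w"
  have inv: "inverse D * D = 1" by (rule inverse_mult_eq_1) (simp add: D_def)
  have w0: "w $ 0 = 0" by (simp add: w_def D_def)
  have zw0: "(fps_const z * w) $ 0 = 0" by (simp add: w0)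
  have inv': "inverse (1 - fps_const z * w) * (1 - fps_const z * w) = 1"
    by (rule inverse_mult_eq_1) (simp add: w0)
  have "Abs_fps (binom_k_sum u v z) = g * inverse (1 - fps_const z * w)"
  proof (rule fps_ext)
    fix n
    show "Abs_fps (binom_k_sum u v z) $ n = (g * inverse (1 - fps_const z * w)) $ n"
    proof (cases "n = 0")
      case True
      then show ?thesis by (simp add: binom_k_sum_def g_def)
    next
      case False
      \<comment> \<open>The geometric series is cut at \<open>n\<close> terms: the rest has order above \<open>n\<close>.\<close>
      define G where "G = (\<Sum>i<n. (fps_const z * w) ^ i)"
      have divide_k: "\<rho> (real n / real k) * x = y" if "of_nat n * x = of_nat k * y" "k > 0" for x y and k :: nat
        using that by (simp add: divide field_simps)
      have summand: "z ^ k * \<rho> (real n / real k) * (w ^ k) $ n = (g * (fps_const z * w) ^ (k - 1)) $ n"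
        if "k \<in> {1..n}" for k
      proof -
        define i where "i = k - 1"
        have k: "k = Suc i" using that by (simp add: i_def)
        have "of_nat n * (w ^ k) $ n = (fps_X * fps_deriv (w ^ k)) $ n"
          using False by (cases n) simp_all
        also have "fps_deriv (w ^ k) = of_nat k * w ^ i * fps_deriv w"
          using fps_deriv_power[of w k] by (simp add: k fps_of_nat[symmetric] algebra_simps)
        also have "(fps_X * (of_nat k * w ^ i * fps_deriv w)) $ n = of_nat k * (fps_X * fps_deriv w * w ^ i) $ n"
          by (simp only: fps_of_nat[symmetric] fps_mult_left_const_nth mult.assoc mult.left_commute[of _ "fps_const _"] mult.commute[of "w ^ i"])
        finally have "\<rho> (real n / real k) * (w ^ k) $ n = (fps_X * fps_deriv w * w ^ i) $ n"
          by (rule divide_k) (simp add: k)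
        then have "z ^ k * \<rho> (real n / real k) * (w ^ k) $ n = (fps_const (z ^ k) * (fps_X * fps_deriv w * w ^ i)) $ n"
          by (simp add: mult.assoc)
        also have "fps_const (z ^ k) * (fps_X * fps_deriv w * w ^ i) = g * (fps_const z * w) ^ (k - 1)"
        proof -
          have "fps_const (z ^ k) = fps_const z * fps_const z ^ i" by (simp add: k)
          then show ?thesis
            by (simp add: g_def k power_mult_distrib mult_ac del: fps_const_power fps_const_mult)
        qed
        finally show ?thesis .
      qed
      have "Abs_fps (binom_k_sum u v z) $ n = (\<Sum>k=1..n. (g * (fps_const z * w) ^ (k - 1)) $ n)"
        by (simp add: binom_k_sum_eq_nth flip: D_def w_def) (rule sum.cong, use summand in auto)
      also have "\<dots> = (\<Sum>i<n. (g * (fps_const z * w) ^ i) $ n)"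
        by (rule sum.reindex_bij_witness[of _ Suc "\<lambda>k. k - 1"]) auto
      also have "\<dots> = (g * G) $ n"
        by (simp add: G_def sum_distrib_left fps_sum_nth)
      also have "G = inverse (1 - fps_const z * w) - (fps_const z * w) ^ n * inverse (1 - fps_const z * w)"
      proof -
        have "G * (1 - fps_const z * w) = 1 - (fps_const z * w) ^ n"
          unfolding G_def by (metis one_diff_power_eq mult.commute)
        moreover have "G * (inverse (1 - fps_const z * w) * (1 - fps_const z * w))
            = G * (1 - fps_const z * w) * inverse (1 - fps_const z * w)"
          by (simp only: ac_simps)
        ultimately have "G * (inverse (1 - fps_const z * w) * (1 - fps_const z * w)) =
          (1 - (fps_const z * w) ^ n) * inverse (1 - fps_const z * w)" by simp
        then show ?thesis unfolding inv' by (simp add: algebra_simps)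
      qed
      also have "(g * (inverse (1 - fps_const z * w) - (fps_const z * w) ^ n * inverse (1 - fps_const z * w))) $ n
         = (g * inverse (1 - fps_const z * w)) $ n
           - (fps_X * ((fps_const z * w) ^ n * (fps_const z * fps_deriv w * inverse (1 - fps_const z * w)))) $ n"
        by (simp add: g_def algebra_simps)
      also have "(fps_X * ((fps_const z * w) ^ n * (fps_const z * fps_deriv w * inverse (1 - fps_const z * w)))) $ n = 0"
      proof -
        have "((fps_const z * w) ^ n * h) $ j = 0" if "j < n" for h j
          using startsby_zero_power_prefix[OF zw0] that by (simp add: fps_mult_nth)
        then show ?thesis using False by simp
      qed
      finally show ?thesis by simp
    qed
  qed
  then have phi: "Abs_fps (binom_k_sum u v z) * (1 - fps_const z * w) = g"
    using inv' by (simp add: mult.assoc)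
  have wD: "(1 + w) * D = 1" using inv by (simp add: w_def)
  have P: "fps_const (1 + z) * D - fps_const z = (1 - fps_const z * w) * D"
  proof -
    have "(1 - fps_const z * w) * D = D + fps_const z * D - fps_const z * ((1 + w) * D)"
      by (simp add: algebra_simps)
    then show ?thesis unfolding wD by (simp add: algebra_simps fps_const_add[symmetric] del: fps_const_add)
  qed
  have "fps_deriv ((1 + w) * D) = 0" unfolding wD by simp
  then have w': "fps_deriv w * D = - (1 + w) * fps_deriv D"
    by (simp add: algebra_simps eq_neg_iff_add_eq_0)
  have "Abs_fps (binom_k_sum u v z) * (D * (fps_const (1 + z) * D - fps_const z))
     = (Abs_fps (binom_k_sum u v z) * (1 - fps_const z * w)) * D * D"
    unfolding P by (simp add: algebra_simps)
  also have "\<dots> = fps_const z * fps_X * (fps_deriv w * D) * D"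
    unfolding phi g_def by (simp add: algebra_simps)
  also have "\<dots> = - fps_const z * fps_X * fps_deriv D * ((1 + w) * D)"
    unfolding w' by (simp add: algebra_simps del: fps_const_neg)
  finally show ?thesis unfolding wD by simp
qed

end

section \<open>Sums over partitions as exponentials\<close>

text \<open>Removing one part from a partition is simpler for multisets than for sorted lists.\<close>
definition mpartitions :: "nat \<Rightarrow> nat multiset set" where
  "mpartitions n = {M. 0 \<notin># M \<and> sum_mset M = n}"

definition z_mset :: "nat multiset \<Rightarrow> real" where
  "z_mset M = (\<Prod>i\<in>set_mset M. real i ^ count M i * fact (count M i))"

lemma bij_betw_mset_partitions: "bij_betw mset (partitions_of n) (mpartitions n)"
proof (rule bij_betwI[where g = "\<lambda>M. rev (sorted_list_of_multiset M)"])
  show "mset \<in> partitions_of n \<rightarrow> mpartitions n"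
    by (auto simp: partitions_of_def is_partition_def mpartitions_def sum_mset_sum_list)
  show "(\<lambda>M. rev (sorted_list_of_multiset M)) \<in> mpartitions n \<rightarrow> partitions_of n"
  proof
    fix M assume M: "M \<in> mpartitions n"
    have "sorted_wrt (\<ge>) (rev (sorted_list_of_multiset M))"
      by (simp add: sorted_wrt_rev)
    moreover have "sum_list (sorted_list_of_multiset M) = n"
      using M sum_mset_sum_list[of "sorted_list_of_multiset M"] by (simp add: mpartitions_def)
    moreover have "\<forall>i\<in>#M. 0 < i" using M by (auto simp: mpartitions_def intro: gr0I)
    ultimately show "rev (sorted_list_of_multiset M) \<in> partitions_of n"
      by (simp add: partitions_of_def is_partition_def sum_list_rev)
  qed
next
  fix xs assume "xs \<in> partitions_of n"
  then have "sorted (rev xs)" by (simp add: partitions_of_def is_partition_def sorted_wrt_rev)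
  then have "sorted_list_of_multiset (mset xs) = rev xs"
    by (metis mset_rev sorted_list_of_multiset_mset sorted_sort_id)
  then show "rev (sorted_list_of_multiset (mset xs)) = xs" by simp
qed simp

lemma finite_mpartitions: "finite (mpartitions n)"
  using bij_betw_mset_partitions finite_partitions_of by (metis bij_betw_finite)

lemma z_mset_mset: "z_mset (mset xs) = z_part xs"
  by (simp add: z_mset_def z_part_def count_mset)

lemma z_mset_superset:
  "finite A \<Longrightarrow> set_mset M \<subseteq> A \<Longrightarrow> z_mset M = (\<Prod>i\<in>A. real i ^ count M i * fact (count M i))"
  unfolding z_mset_def by (rule prod.mono_neutral_left) (auto simp: not_in_iff)

text \<open>This is the reason for the weights \<open>1 / z\<close>: multiplied by \<open>r\<close> times the multiplicity of
\<open>r\<close>, the weight of a partition becomes the weight of the partition with one part \<open>r\<close> removed.\<close>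
lemma z_mset_add_mset: "z_mset (add_mset r M) = real (r * count (add_mset r M) r) * z_mset M"
proof -
  let ?A = "insert r (set_mset M)"
  have "z_mset (add_mset r M) = (\<Prod>i\<in>?A. real i ^ count (add_mset r M) i * fact (count (add_mset r M) i))"
    by (rule z_mset_superset) auto
  also have "\<dots> = real r ^ count (add_mset r M) r * fact (count (add_mset r M) r) *
     (\<Prod>i\<in>?A - {r}. real i ^ count (add_mset r M) i * fact (count (add_mset r M) i))"
    by (rule prod.remove) auto
  also have "(\<Prod>i\<in>?A - {r}. real i ^ count (add_mset r M) i * fact (count (add_mset r M) i))
    = (\<Prod>i\<in>?A - {r}. real i ^ count M i * fact (count M i))"
    by (rule prod.cong) auto
  also have "real r ^ count (add_mset r M) r * fact (count (add_mset r M) r) *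
     (\<Prod>i\<in>?A - {r}. real i ^ count M i * fact (count M i))
     = real (r * count (add_mset r M) r) * (real r ^ count M r * fact (count M r) *
     (\<Prod>i\<in>?A - {r}. real i ^ count M i * fact (count M i)))"
    by (simp add: algebra_simps)
  also have "real r ^ count M r * fact (count M r) *
     (\<Prod>i\<in>?A - {r}. real i ^ count M i * fact (count M i)) = (\<Prod>i\<in>?A. real i ^ count M i * fact (count M i))"
    by (rule prod.remove[symmetric]) auto
  also have "\<dots> = z_mset M" by (rule z_mset_superset[symmetric]) auto
  finally show ?thesis .
qed

lemma sum_mset_conv_sum_count: "sum_mset M = (\<Sum>r\<in>set_mset M. r * count M r)" for M :: "nat multiset"
proof -
  obtain xs where M: "M = mset xs" using ex_mset[of M] by auto
  show ?thesis
    using sum_list_map_eq_sum_count[of "\<lambda>x. x" xs]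
    by (simp add: M sum_mset_sum_list count_mset mult.commute)
qed

context real_scalars
begin

text \<open>The coefficient of \<open>X\<^sup>n\<close> in \<open>exp (\<Sum>r\<ge>1. a r X\<^sup>r / r)\<close>; for power sums \<open>a\<close> it is a
complete homogeneous symmetric function.\<close>
definition cycle_sum :: "(nat \<Rightarrow> 'a) \<Rightarrow> nat \<Rightarrow> 'a" where
  "cycle_sum a n = (\<Sum>M\<in>mpartitions n. \<rho> (1 / z_mset M) * (\<Prod>i\<in>#M. a i))"

lemma cycle_sum_0 [simp]: "cycle_sum a 0 = 1"
proof -
  have "mpartitions 0 = {{#}}" by (auto simp: mpartitions_def) (metis multiset_nonemptyE)
  then show ?thesis by (simp add: cycle_sum_def z_mset_def one)
qed

text \<open>Write \<open>n\<close> as the sum of \<open>r\<close> times the multiplicity of \<open>r\<close> over the different parts \<open>r\<close> of the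
partition and remove a part \<open>r\<close>: pairs of a partition of \<open>n\<close> and one of its parts \<open>r\<close> correspond to
pairs of \<open>r\<close> and a partition of \<open>n - r\<close>.\<close>
lemma cycle_sum_rec: "of_nat n * cycle_sum a n = (\<Sum>r=1..n. a r * cycle_sum a (n - r))"
proof -
  let ?t = "\<lambda>M. \<rho> (1 / z_mset M) * (\<Prod>i\<in>#M. a i)"
  have "of_nat n * cycle_sum a n = (\<Sum>M\<in>mpartitions n. \<Sum>r\<in>set_mset M. of_nat (r * count M r) * ?t M)"
    unfolding cycle_sum_def sum_distrib_left
  proof (rule sum.cong)
    fix M assume "M \<in> mpartitions n"
    then have "n = (\<Sum>r\<in>set_mset M. r * count M r)"
      by (simp add: mpartitions_def sum_mset_conv_sum_count)
    then show "of_nat n * ?t M = (\<Sum>r\<in>set_mset M. of_nat (r * count M r) * ?t M)"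
      by (simp only: of_nat_sum flip: sum_distrib_right)
  qed simp
  also have "\<dots> = (\<Sum>(M, r)\<in>Sigma (mpartitions n) set_mset. of_nat (r * count M r) * ?t M)"
    by (rule sum.Sigma) (auto simp: finite_mpartitions)
  also have "\<dots> = (\<Sum>(r, M)\<in>Sigma {1..n} (\<lambda>r. mpartitions (n - r)). a r * ?t M)"
  proof (rule sum.reindex_bij_witness[where j = "\<lambda>(M, r). (r, M - {#r#})" and i = "\<lambda>(r, M). (add_mset r M, r)"])
    fix b assume "b \<in> Sigma {1..n} (\<lambda>r. mpartitions (n - r))"
    then show "(case b of (r, M) \<Rightarrow> (add_mset r M, r)) \<in> Sigma (mpartitions n) set_mset"
      by (auto simp: mpartitions_def)
  next
    fix b assume b: "b \<in> Sigma (mpartitions n) set_mset"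
    then obtain M r where br: "b = (M, r)" and M: "M \<in> mpartitions n" "r \<in># M" by auto
    define M' where "M' = M - {#r#}"
    have MM': "M = add_mset r M'" using M by (simp add: M'_def)
    have r: "r > 0" using M by (auto simp: mpartitions_def intro: gr0I)
    have "0 \<notin># M'" "n = r + sum_mset M'" using M by (auto simp: mpartitions_def MM')
    then show "(case b of (M, r) \<Rightarrow> (r, M - {#r#})) \<in> Sigma {1..n} (\<lambda>r. mpartitions (n - r))"
      using r by (simp add: br mpartitions_def flip: M'_def)
    have z: "1 / z_mset M = 1 / real (r * count M r) * (1 / z_mset M')" unfolding MM' z_mset_add_mset by simp
    have "r * count M r \<noteq> 0" using r by (simp add: MM')
    then have "real (r * count M r) \<noteq> 0" by (simp only: of_nat_eq_0_iff not_False_eq_True)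
    then have "\<rho> (real (r * count M r)) * \<rho> (1 / z_mset M) = \<rho> (1 / z_mset M')"
      unfolding z by (simp del: of_nat of_nat_mult flip: mult)
    then have "of_nat (r * count M r) * \<rho> (1 / z_mset M) = \<rho> (1 / z_mset M')"
      by (simp only: of_nat)
    moreover have "(\<Prod>i\<in>#M. a i) = a r * (\<Prod>i\<in>#M'. a i)" by (simp add: MM')
    ultimately have "of_nat (r * count M r) * ?t M = a r * ?t M'"
      by (metis mult.assoc mult.left_commute)
    then show "(case case b of (M, r) \<Rightarrow> (r, M - {#r#}) of (r, M) \<Rightarrow> a r * ?t M)
       = (case b of (M, r) \<Rightarrow> of_nat (r * count M r) * ?t M)"
      by (simp add: br flip: M'_def)
  qed auto
  also have "\<dots> = (\<Sum>r=1..n. \<Sum>M\<in>mpartitions (n - r). a r * ?t M)"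
    by (rule sum.Sigma[symmetric]) (auto simp: finite_mpartitions)
  finally show ?thesis by (simp add: cycle_sum_def sum_distrib_left)
qed

end

text \<open>The equation \<open>X f' = a f\<close> determines \<open>n f\<^sub>n\<close> from the earlier coefficients, and \<open>n\<close> is
invertible in characteristic 0.\<close>
lemma fps_log_deriv_unique:
  fixes f g a :: "'a::field_char_0 fps"
  assumes f: "fps_X * fps_deriv f = a * f" and g: "fps_X * fps_deriv g = a * g"
    and "f $ 0 = g $ 0" and a: "a $ 0 = 0"
  shows "f = g"
proof -
  have rec: "of_nat n * h $ n = (\<Sum>r=1..n. a $ r * h $ (n - r))" if "fps_X * fps_deriv h = a * h" for n h
  proof -
    have "of_nat n * h $ n = (fps_X * fps_deriv h) $ n" by (cases n) simp_all
    also have "\<dots> = (\<Sum>r=0..n. a $ r * h $ (n - r))" unfolding that by (simp add: fps_mult_nth)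
    also have "\<dots> = (\<Sum>r=1..n. a $ r * h $ (n - r))" by (simp add: sum.atLeast_Suc_atMost a)
    finally show ?thesis .
  qed
  have "f $ n = g $ n" for n
  proof (induction n rule: less_induct)
    case (less n)
    show ?case
    proof (cases "n = 0")
      case False
      have "(\<Sum>r=1..n. a $ r * f $ (n - r)) = (\<Sum>r=1..n. a $ r * g $ (n - r))"
        by (rule sum.cong) (use less False in auto)
      then have "of_nat n * f $ n = of_nat n * g $ n" using rec[OF f] rec[OF g] by metis
      then show ?thesis using False by simp
    qed (use assms in simp)
  qed
  then show ?thesis by (rule fps_ext)
qed

lemma fps_log_deriv_prod:
  fixes f a :: "'i \<Rightarrow> 'a::field_char_0 fps"
  assumes "finite I" "\<And>i. i \<in> I \<Longrightarrow> fps_X * fps_deriv (f i) = a i * f i"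
  shows "fps_X * fps_deriv (\<Prod>i\<in>I. f i) = (\<Sum>i\<in>I. a i) * (\<Prod>i\<in>I. f i)"
  using assms
proof (induction I rule: finite_induct)
  case (insert i I)
  have "fps_X * fps_deriv (f i * prod f I) = (fps_X * fps_deriv (f i)) * prod f I + f i * (fps_X * fps_deriv (prod f I))"
    by (simp add: algebra_simps)
  also have "\<dots> = a i * f i * prod f I + f i * (sum a I * prod f I)" using insert by simp
  finally show ?case using insert by (simp add: algebra_simps)
qed simp

context real_scalars
begin

lemma cycle_sum_deriv:
  "a 0 = 0 \<Longrightarrow> fps_X * fps_deriv (Abs_fps (cycle_sum a)) = Abs_fps a * Abs_fps (cycle_sum a)"
proof (rule fps_ext)
  fix n assume a: "a 0 = 0"
  have "(fps_X * fps_deriv (Abs_fps (cycle_sum a))) $ n = of_nat n * cycle_sum a n"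
    by (cases n) simp_all
  also have "\<dots> = (\<Sum>r=0..n. a r * cycle_sum a (n - r))"
    by (simp add: cycle_sum_rec sum.atLeast_Suc_atMost a)
  finally show "(fps_X * fps_deriv (Abs_fps (cycle_sum a))) $ n = (Abs_fps a * Abs_fps (cycle_sum a)) $ n"
    by (simp add: fps_mult_nth)
qed

text \<open>This is \<open>1 - z w\<close>, with \<open>w = 1/D - 1\<close>, after clearing the denominator \<open>D = cell_poly u v\<close>.\<close>
definition cell_den :: "'a \<Rightarrow> 'a \<Rightarrow> 'a \<Rightarrow> 'a fps" where
  "cell_den u v z = fps_const (1 + z) * cell_poly u v - fps_const z"

lemma cell_den_nth_0 [simp]: "cell_den u v z $ 0 = 1"
  by (simp add: cell_den_def)

text \<open>By this homogeneity a power sum times \<open>binom_k_sum u v z n\<close> is a sum of terms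
\<open>binom_k_sum\<close>, one for each cell with \<open>u\<close> and \<open>v\<close> multiplied by its content.\<close>
lemma binom_k_sum_scale: "binom_k_sum (c * u) (c * v) z n = c ^ n * binom_k_sum u v z n"
proof -
  have scale: "(c * u) ^ p * (c * v) ^ (n - p) = c ^ n * (u ^ p * v ^ (n - p))" if "p \<le> n" for p
    using that by (simp add: power_mult_distrib algebra_simps flip: power_add)
  show ?thesis
    unfolding binom_k_sum_def sum_distrib_left
  proof (intro sum.cong refl)
    fix p k assume "p \<in> {..n}"
    then have "\<rho> (binom_k n p k) * ((c * u) ^ p * (c * v) ^ (n - p)) * z ^ k
       = \<rho> (binom_k n p k) * (c ^ n * (u ^ p * v ^ (n - p))) * z ^ k"
      using scale by simp
    then show "\<rho> (binom_k n p k) * (c * u) ^ p * (c * v) ^ (n - p) * z ^ k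
       = c ^ n * (\<rho> (binom_k n p k) * u ^ p * v ^ (n - p) * z ^ k)"
      by (simp only: ac_simps)
  qed
qed

text \<open>Both \<open>cycle_sum a\<close> and the quotient of the two products have the logarithmic derivative
\<open>\<Sum>n. a n X\<^sup>n / X\<close>: the first by its recurrence, the second cell by cell from
\<open>binom_k_sum_series\<close>.\<close>
lemma cycle_sum_cells:
  fixes c :: "'i \<Rightarrow> 'a" and u v z :: 'a
  assumes "finite I"
  defines "a \<equiv> (\<lambda>n. (\<Sum>i\<in>I. c i ^ n) * binom_k_sum u v z n)"
  shows "Abs_fps (cycle_sum a) * (\<Prod>i\<in>I. cell_den (c i * u) (c i * v) z)
    = (\<Prod>i\<in>I. cell_poly (c i * u) (c i * v))"
proof -
  define b where "b i = Abs_fps (binom_k_sum (c i * u) (c i * v) z)" for i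
  define D P where "D i = cell_poly (c i * u) (c i * v)" and "P i = cell_den (c i * u) (c i * v) z" for i
  define R where "R i = D i * inverse (P i)" for i
  have inv: "inverse (P i) * P i = 1" for i by (rule inverse_mult_eq_1) (simp add: P_def)
  have R: "fps_X * fps_deriv (R i) = b i * R i" for i
  proof -
    have PD: "P i = fps_const (1 + z) * D i - fps_const z" by (simp add: P_def D_def cell_den_def)
    have b: "b i * (D i * P i) = - fps_const z * fps_X * fps_deriv (D i)"
      unfolding PD unfolding b_def D_def by (rule binom_k_sum_series)
    have RP: "R i * P i = D i" using inv[of i] by (simp add: R_def mult.assoc)
    have "fps_deriv (R i) * P i + R i * fps_deriv (P i) = fps_deriv (D i)"
      unfolding RP[symmetric] by simp
    then have "(fps_deriv (R i) * P i + R i * fps_deriv (P i)) * P i = fps_deriv (D i) * P i" by simp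
    then have "fps_deriv (R i) * P i * P i + (R i * P i) * fps_deriv (P i) = fps_deriv (D i) * P i"
      by (simp add: algebra_simps)
    then have "fps_deriv (R i) * P i * P i = fps_deriv (D i) * P i - D i * fps_deriv (P i)"
      unfolding RP by (simp add: algebra_simps)
    also have "\<dots> = - fps_const z * fps_deriv (D i)"
      unfolding PD by (simp add: algebra_simps del: fps_const_neg)
    finally have "fps_X * fps_deriv (R i) * P i * P i = b i * (D i * P i)"
      unfolding b by (simp add: algebra_simps)
    then have "fps_X * fps_deriv (R i) * P i * P i = b i * R i * P i * P i"
      using RP by (simp add: mult.assoc)
    moreover have "P i \<noteq> 0" using inv[of i] by auto
    ultimately show ?thesis by simp
  qed
  have "a 0 = 0" by (simp add: a_def binom_k_sum_def)
  have sum_b: "(\<Sum>i\<in>I. b i) = Abs_fps a"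
    by (rule fps_ext) (simp add: b_def a_def fps_sum_nth binom_k_sum_scale sum_distrib_right)
  have "Abs_fps (cycle_sum a) = prod R I"
  proof (rule fps_log_deriv_unique)
    show "fps_X * fps_deriv (Abs_fps (cycle_sum a)) = Abs_fps a * Abs_fps (cycle_sum a)"
      by (rule cycle_sum_deriv) fact
    show "fps_X * fps_deriv (prod R I) = Abs_fps a * prod R I"
      using fps_log_deriv_prod[OF assms(1) R] sum_b by simp
    have "prod R J $ 0 = 1" if "finite J" for J
      using that by (induction J rule: finite_induct) (simp_all add: R_def D_def P_def)
    from this[OF assms(1)] show "Abs_fps (cycle_sum a) $ 0 = prod R I $ 0"
      by simp
    show "Abs_fps a $ 0 = 0" using \<open>a 0 = 0\<close> by simp
  qed
  moreover have "prod R I * prod P I = prod D I"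
    unfolding prod.distrib[symmetric] R_def using inv by (simp add: mult.assoc)
  ultimately show ?thesis by (simp add: P_def D_def)
qed

end

section \<open>The generating function of the numbers F\<close>

lemma sum_listset_Cons:
  assumes "finite A" "\<forall>B\<in>set As. finite B"
  shows "(\<Sum>xs\<in>listset (A # As). f xs) = (\<Sum>a\<in>A. \<Sum>xs\<in>listset As. f (a # xs))"
proof -
  have "listset (A # As) = (\<lambda>(a, xs). a # xs) ` (A \<times> listset As)"
    by (auto simp: set_Cons_def)
  moreover have "inj_on (\<lambda>(a, xs). a # xs) (A \<times> listset As)"
    by (auto simp: inj_on_def)
  ultimately show ?thesis
    by (simp add: sum.reindex sum.cartesian_product case_prod_beta' o_def)
qed

lemma finite_listset: "\<forall>B\<in>set As. finite B \<Longrightarrow> finite (listset As)"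
  by (induction As) (auto simp: set_Cons_def intro: finite_image_set2)

lemma listset_conv_nth:
  "listset As = {xs. length xs = length As \<and> (\<forall>i<length As. xs ! i \<in> As ! i)}"
proof (induction As)
  case (Cons A As)
  show ?case
    unfolding listset.simps set_Cons_def Cons
  proof (intro Collect_cong iffI)
    fix xs
    assume "length xs = length (A # As) \<and> (\<forall>i<length (A # As). xs ! i \<in> (A # As) ! i)"
    then show "\<exists>y ys. xs = y # ys \<and> y \<in> A \<and> ys \<in> {xs. length xs = length As \<and> (\<forall>i<length As. xs ! i \<in> As ! i)}"
      by (cases xs) (auto simp: All_less_Suc2)
  qed (auto simp: nth_Cons split: nat.splits)
qed auto

definition binom_k_prod :: "nat list \<Rightarrow> nat list \<Rightarrow> nat list \<Rightarrow> real" where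
  "binom_k_prod \<mu> ps ks = (\<Prod>i<length \<mu>. binom_k (\<mu> ! i) (ps ! i) (ks ! i))"

lemma binom_k_prod_Cons [simp]:
  "binom_k_prod (m # \<mu>) (p # ps) (k # ks) = binom_k m p k * binom_k_prod \<mu> ps ks"
  unfolding binom_k_prod_def by (simp add: prod.lessThan_Suc_shift del: prod.lessThan_Suc)

lemma binom_k_prod_Nil [simp]: "binom_k_prod [] ps ks = 1"
  by (simp add: binom_k_prod_def)

lemma binom_k_eq_0:
  assumes "p \<le> n" "n < k" "n > 0"
  shows "binom_k n p k = 0"
proof -
  have "ibinom (int p) (int r) * ibinom (int n - int p) (int r) * ibinom (int n - int r - 1) (int k - int r - 1) = 0" for r
  proof (cases "r \<le> p \<and> r \<le> n - p")
    case True
    then have "int n - int r - 1 = int (n - r - 1)" "int k - int r - 1 = int (k - r - 1)" "n - r - 1 < k - r - 1"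
      using assms by linarith+
    then have "ibinom (int n - int r - 1) (int k - int r - 1) = 0"
      by (simp only: ibinom_of_nat) (simp add: binomial_eq_0)
    then show ?thesis by simp
  next
    case False
    then show ?thesis
      using assms(1) ibinom_of_nat[of p r] ibinom_of_nat[of "n - p" r] by (auto simp: of_nat_diff)
  qed
  then show ?thesis unfolding binom_k_def by (simp only: sum.neutral_const mult_zero_right)
qed

text \<open>The choices for all \<open>p\<^sub>i\<close> and for all \<open>k\<^sub>i\<close> without a condition on their sums. They are
products of intervals, so sums over them factor.\<close>
definition part_boxes :: "nat list \<Rightarrow> nat list set" where
  "part_boxes \<mu> = listset (map (\<lambda>m. {..m}) \<mu>)"

definition pos_boxes :: "nat list \<Rightarrow> nat list set" where
  "pos_boxes \<mu> = listset (map (\<lambda>m. {1..m}) \<mu>)"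

lemma finite_boxes [simp]: "finite (part_boxes \<mu>)" "finite (pos_boxes \<mu>)"
  by (auto simp: part_boxes_def pos_boxes_def intro!: finite_listset)

lemma sum_list_boxes:
  "xs \<in> part_boxes \<mu> \<Longrightarrow> sum_list xs \<le> sum_list \<mu>"
  "xs \<in> pos_boxes \<mu> \<Longrightarrow> sum_list xs \<le> sum_list \<mu>"
  by (induction \<mu> arbitrary: xs) (auto simp: part_boxes_def pos_boxes_def set_Cons_def intro!: add_mono)

text \<open>The decompositions of \<open>k\<close> have no upper bound on their parts, but those with
\<open>k\<^sub>i > \<mu>\<^sub>i\<close> contribute 0.\<close>
lemma angle_k_eq_sum_boxes:
  assumes "\<forall>m\<in>set \<mu>. 0 < m"
  shows "angle_k \<mu> p k = (\<Sum>ps | ps \<in> part_boxes \<mu> \<and> sum_list ps = p.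
    \<Sum>ks | ks \<in> pos_boxes \<mu> \<and> sum_list ks = k. binom_k_prod \<mu> ps ks)"
  unfolding angle_k_def binom_k_prod_def[symmetric]
proof (rule sum.cong)
  show p: "p_decomps \<mu> p = {ps. ps \<in> part_boxes \<mu> \<and> sum_list ps = p}"
    by (auto simp: p_decomps_def part_boxes_def listset_conv_nth)
  fix ps assume "ps \<in> {ps. ps \<in> part_boxes \<mu> \<and> sum_list ps = p}"
  then have ps: "ps ! i \<le> \<mu> ! i" if "i < length \<mu>" for i
    using that by (auto simp: part_boxes_def listset_conv_nth)
  show "(\<Sum>ks\<in>k_decomps \<mu> k. binom_k_prod \<mu> ps ks)
      = (\<Sum>ks | ks \<in> pos_boxes \<mu> \<and> sum_list ks = k. binom_k_prod \<mu> ps ks)"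
  proof (rule sum.mono_neutral_right)
    show "{ks. ks \<in> pos_boxes \<mu> \<and> sum_list ks = k} \<subseteq> k_decomps \<mu> k"
      by (auto simp: k_decomps_def pos_boxes_def listset_conv_nth)
    show "\<forall>ks\<in>k_decomps \<mu> k - {ks. ks \<in> pos_boxes \<mu> \<and> sum_list ks = k}. binom_k_prod \<mu> ps ks = 0"
    proof
      fix ks assume "ks \<in> k_decomps \<mu> k - {ks. ks \<in> pos_boxes \<mu> \<and> sum_list ks = k}"
      then obtain i where i: "i < length \<mu>" "\<mu> ! i < ks ! i"
        by (auto simp: k_decomps_def pos_boxes_def listset_conv_nth not_le)
      then have "binom_k (\<mu> ! i) (ps ! i) (ks ! i) = 0"
        using assms ps by (intro binom_k_eq_0) auto
      then show "binom_k_prod \<mu> ps ks = 0"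
        using i(1) unfolding binom_k_prod_def by (intro prod_zero) auto
    qed
  qed (rule finite_k_decomps)
qed

text \<open>The convention for \<open>k = 0\<close> agrees with the general formula: a nonempty partition has no
decomposition with \<open>k = 0\<close>, and the empty one contributes 1.\<close>
lemma F_fun_eq:
  assumes "p \<le> n"
  shows "F_fun \<alpha> n p k lam = (\<Sum>\<mu>\<in>partitions_of n. 1 / z_part \<mu> * angle_k \<mu> p k * d_part \<alpha> lam \<mu>)"
proof (cases "k = 0")
  case k: True
  show ?thesis
  proof (cases "n = 0")
    case True
    have "partitions_of 0 = {[]}"
      by (auto simp: partitions_of_def is_partition_def) (metis list.set_intros(1) list.exhaust less_irrefl)
    moreover have "p_decomps [] 0 = {[]}" "k_decomps [] 0 = {[]}"
      by (auto simp: p_decomps_def k_decomps_def)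
    ultimately show ?thesis using True k assms
      by (simp add: F_fun_def z_part_def angle_k_def d_part_def)
  next
    case False
    have "angle_k \<mu> p 0 = 0" if "\<mu> \<in> partitions_of n" for \<mu>
    proof -
      have "\<mu> \<noteq> []" using that False by (auto simp: partitions_of_def)
      have "False" if "ks \<in> k_decomps \<mu> 0" for ks
      proof -
        have "1 \<le> ks ! 0" "ks ! 0 \<in> set ks"
          using that \<open>\<mu> \<noteq> []\<close> by (auto simp: k_decomps_def)
        then show False
          using that by (auto simp: k_decomps_def)
      qed
      then have "k_decomps \<mu> 0 = {}" by blast
      then show ?thesis by (simp add: angle_k_def)
    qed
    then show ?thesis using False k by (simp add: F_fun_def)
  qed
qed (simp add: F_fun_def)

lemma d_part_eq: "d_part \<alpha> lam \<mu> = (\<Prod>m\<leftarrow>\<mu>. d_pow \<alpha> lam m)"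
  unfolding d_part_def
  using image_prod_mset_multiplicity[of "d_pow \<alpha> lam" "mset \<mu>"]
  by (simp add: count_mset prod_mset_prod_list flip: mset_map)

lemma prod_list_mult: "(\<Prod>x\<leftarrow>xs. f x) * (\<Prod>x\<leftarrow>xs. g x) = (\<Prod>x\<leftarrow>xs. f x * g x)"
  for f g :: "'b \<Rightarrow> 'c::comm_monoid_mult"
  by (induction xs) (simp_all add: ac_simps)

context real_scalars
begin

lemma sum_boxes:
  "(\<Sum>ps\<in>part_boxes \<mu>. \<Sum>ks\<in>pos_boxes \<mu>.
      \<rho> (binom_k_prod \<mu> ps ks) * u ^ sum_list ps * v ^ (sum_list \<mu> - sum_list ps) * z ^ sum_list ks)
    = (\<Prod>m\<leftarrow>\<mu>. binom_k_sum u v z m)"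
proof (induction \<mu>)
  case Nil
  then show ?case by (simp add: part_boxes_def pos_boxes_def one)
next
  case (Cons m \<mu>)
  let ?f = "\<lambda>\<mu> ps ks. \<rho> (binom_k_prod \<mu> ps ks) * u ^ sum_list ps * v ^ (sum_list \<mu> - sum_list ps) * z ^ sum_list ks"
  let ?g = "\<lambda>p k. \<rho> (binom_k m p k) * u ^ p * v ^ (m - p) * z ^ k"
  have "(\<Sum>ps\<in>part_boxes (m # \<mu>). \<Sum>ks\<in>pos_boxes (m # \<mu>). ?f (m # \<mu>) ps ks)
     = (\<Sum>p\<le>m. \<Sum>ps\<in>part_boxes \<mu>. \<Sum>k=1..m. \<Sum>ks\<in>pos_boxes \<mu>. ?f (m # \<mu>) (p # ps) (k # ks))"
    unfolding part_boxes_def pos_boxes_def list.map by (simp add: sum_listset_Cons del: listset.simps)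
  also have "\<dots> = (\<Sum>p\<le>m. \<Sum>ps\<in>part_boxes \<mu>. \<Sum>k=1..m. \<Sum>ks\<in>pos_boxes \<mu>. ?g p k * ?f \<mu> ps ks)"
  proof (intro sum.cong refl)
    fix p ps k ks assume "p \<in> {..m}" "ps \<in> part_boxes \<mu>"
    then have "sum_list (m # \<mu>) - sum_list (p # ps) = (m - p) + (sum_list \<mu> - sum_list ps)"
      using sum_list_boxes(1)[of ps \<mu>] by simp
    then show "?f (m # \<mu>) (p # ps) (k # ks) = ?g p k * ?f \<mu> ps ks"
      by (simp only: binom_k_prod_Cons sum_list.Cons power_add mult ac_simps)
  qed
  also have "\<dots> = (\<Sum>p\<le>m. \<Sum>k=1..m. \<Sum>ps\<in>part_boxes \<mu>. \<Sum>ks\<in>pos_boxes \<mu>. ?g p k * ?f \<mu> ps ks)"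
    by (intro sum.cong refl sum.swap)
  also have "\<dots> = binom_k_sum u v z m * (\<Sum>ps\<in>part_boxes \<mu>. \<Sum>ks\<in>pos_boxes \<mu>. ?f \<mu> ps ks)"
    unfolding binom_k_sum_def sum_distrib_right by (intro sum.cong refl) (simp add: sum_distrib_left)
  finally show ?case using Cons.IH by simp
qed

text \<open>Summation over \<open>p\<close> and \<open>k\<close> removes the conditions on the sums, and the sum over the
boxes is a product over the parts of \<open>\<mu>\<close>.\<close>
lemma angle_k_series:
  assumes "\<forall>m\<in>set \<mu>. 0 < m"
  shows "(\<Sum>p\<le>sum_list \<mu>. \<Sum>k\<le>sum_list \<mu>. \<rho> (angle_k \<mu> p k) * u ^ p * v ^ (sum_list \<mu> - p) * z ^ k)
    = (\<Prod>m\<leftarrow>\<mu>. binom_k_sum u v z m)"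
proof -
  let ?n = "sum_list \<mu>"
  let ?f = "\<lambda>ps ks. \<rho> (binom_k_prod \<mu> ps ks) * u ^ sum_list ps * v ^ (?n - sum_list ps) * z ^ sum_list ks"
  have "(\<Sum>p\<le>?n. \<Sum>k\<le>?n. \<rho> (angle_k \<mu> p k) * u ^ p * v ^ (?n - p) * z ^ k)
    = (\<Sum>p\<le>?n. \<Sum>k\<le>?n. \<Sum>ps | ps \<in> part_boxes \<mu> \<and> sum_list ps = p.
        \<Sum>ks | ks \<in> pos_boxes \<mu> \<and> sum_list ks = k. ?f ps ks)"
    by (intro sum.cong refl) (simp add: angle_k_eq_sum_boxes[OF assms] sum sum_distrib_right)
  also have "\<dots> = (\<Sum>p\<le>?n. \<Sum>ps | ps \<in> part_boxes \<mu> \<and> sum_list ps = p.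
      \<Sum>k\<le>?n. \<Sum>ks | ks \<in> pos_boxes \<mu> \<and> sum_list ks = k. ?f ps ks)"
    by (intro sum.cong refl sum.swap)
  also have "\<dots> = (\<Sum>p\<le>?n. \<Sum>ps | ps \<in> part_boxes \<mu> \<and> sum_list ps = p. \<Sum>ks\<in>pos_boxes \<mu>. ?f ps ks)"
    by (intro sum.cong refl sum.group) (auto dest: sum_list_boxes)
  also have "\<dots> = (\<Sum>ps\<in>part_boxes \<mu>. \<Sum>ks\<in>pos_boxes \<mu>. ?f ps ks)"
    by (intro sum.group) (auto dest: sum_list_boxes)
  finally show ?thesis by (simp add: sum_boxes)
qed

lemma prod_list_hom: "\<rho> (prod_list xs) = (\<Prod>x\<leftarrow>xs. \<rho> x)"
  by (induction xs) (simp_all add: mult one)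

lemma F_fun_series:
  "(\<Sum>p\<le>n. \<Sum>k\<le>n. \<rho> (F_fun \<alpha> n p k lam) * u ^ p * v ^ (n - p) * z ^ k)
    = cycle_sum (\<lambda>m. \<rho> (d_pow \<alpha> lam m) * binom_k_sum u v z m) n"
proof -
  let ?b = "\<lambda>m. \<rho> (d_pow \<alpha> lam m) * binom_k_sum u v z m"
  let ?c = "\<lambda>\<mu>. \<rho> (1 / z_part \<mu>) * \<rho> (d_part \<alpha> lam \<mu>)"
  let ?g = "\<lambda>\<mu> p k. \<rho> (angle_k \<mu> p k) * u ^ p * v ^ (n - p) * z ^ k"
  have "(\<Sum>p\<le>n. \<Sum>k\<le>n. \<rho> (F_fun \<alpha> n p k lam) * u ^ p * v ^ (n - p) * z ^ k)
    = (\<Sum>p\<le>n. \<Sum>k\<le>n. \<Sum>\<mu>\<in>partitions_of n. ?c \<mu> * ?g \<mu> p k)"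
  proof (intro sum.cong refl)
    fix p k assume "p \<in> {..n}"
    then have F: "F_fun \<alpha> n p k lam = (\<Sum>\<mu>\<in>partitions_of n. 1 / z_part \<mu> * angle_k \<mu> p k * d_part \<alpha> lam \<mu>)"
      by (intro F_fun_eq) simp
    show "\<rho> (F_fun \<alpha> n p k lam) * u ^ p * v ^ (n - p) * z ^ k = (\<Sum>\<mu>\<in>partitions_of n. ?c \<mu> * ?g \<mu> p k)"
      unfolding F sum mult sum_distrib_right by (intro sum.cong refl) (simp only: ac_simps)
  qed
  also have "\<dots> = (\<Sum>p\<le>n. \<Sum>\<mu>\<in>partitions_of n. \<Sum>k\<le>n. ?c \<mu> * ?g \<mu> p k)"
    by (intro sum.cong refl sum.swap)
  also have "\<dots> = (\<Sum>\<mu>\<in>partitions_of n. \<Sum>p\<le>n. \<Sum>k\<le>n. ?c \<mu> * ?g \<mu> p k)"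
    by (rule sum.swap)
  also have "\<dots> = (\<Sum>\<mu>\<in>partitions_of n. \<rho> (1 / z_mset (mset \<mu>)) * (\<Prod>i\<in>#mset \<mu>. ?b i))"
  proof (rule sum.cong)
    fix \<mu> assume "\<mu> \<in> partitions_of n"
    then have \<mu>: "sum_list \<mu> = n" "\<forall>m\<in>set \<mu>. 0 < m"
      by (simp_all add: partitions_of_def is_partition_def)
    have "(\<Sum>p\<le>n. \<Sum>k\<le>n. ?c \<mu> * ?g \<mu> p k) = ?c \<mu> * (\<Prod>m\<leftarrow>\<mu>. binom_k_sum u v z m)"
      using angle_k_series[OF \<mu>(2)] by (simp add: \<mu>(1) flip: sum_distrib_left)
    also have "\<dots> = \<rho> (1 / z_part \<mu>) * ((\<Prod>m\<leftarrow>\<mu>. \<rho> (d_pow \<alpha> lam m)) * (\<Prod>m\<leftarrow>\<mu>. binom_k_sum u v z m))"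
      by (simp add: d_part_eq prod_list_hom o_def mult.assoc)
    also have "\<dots> = \<rho> (1 / z_part \<mu>) * (\<Prod>i\<in>#mset \<mu>. ?b i)"
      by (simp add: prod_list_mult prod_mset_prod_list flip: mset_map)
    finally show "(\<Sum>p\<le>n. \<Sum>k\<le>n. ?c \<mu> * ?g \<mu> p k) = \<rho> (1 / z_mset (mset \<mu>)) * (\<Prod>i\<in>#mset \<mu>. ?b i)"
      by (simp add: z_mset_mset)
  qed simp
  also have "\<dots> = cycle_sum ?b n"
    unfolding cycle_sum_def by (rule sum.reindex_bij_betw[OF bij_betw_mset_partitions])
  finally show ?thesis .
qed

end

section \<open>Topology of formal Laurent series\<close>

lemma dist_fls_less_iff:
  fixes f g :: "'a::group_add fls"
  shows "dist f g < inverse (2 ^ m) \<longleftrightarrow> (\<forall>j\<le>int m. f $$ j = g $$ j)"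
proof (cases "f = g")
  case False
  then have ne: "f - g \<noteq> 0" by simp
  let ?d = "fls_subdegree (f - g)"
  have d: "(f - g) $$ ?d \<noteq> 0" using ne by (rule nth_fls_subdegree_nonzero)
  have eq: "(\<forall>j\<le>int m. f $$ j = g $$ j) \<longleftrightarrow> int m < ?d" (is "?L \<longleftrightarrow> ?R")
  proof
    assume ?L
    then show ?R using d by (metis fls_minus_nth not_le right_minus_eq)
  next
    assume R: ?R
    show ?L
    proof (intro allI impI)
      fix j assume "j \<le> int m"
      then have "(f - g) $$ j = 0" using R by (intro fls_eq0_below_subdegree) simp
      then show "f $$ j = g $$ j" by simp
    qed
  qed
  show ?thesis
  proof (cases "?d \<ge> 0")
    case True
    have "dist f g < inverse (2 ^ m) \<longleftrightarrow> (2::real) ^ m < 2 ^ nat ?d"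
      using False True by (simp add: dist_fls_def)
    also have "\<dots> \<longleftrightarrow> int m < ?d" using True by auto
    finally show ?thesis using eq by simp
  next
    case neg: False
    have "inverse ((2::real) ^ m) \<le> 1" by (simp add: inverse_le_1_iff)
    also have "1 \<le> dist f g" using neg False by (simp add: dist_fls_def)
    finally show ?thesis using eq neg by simp
  qed
qed simp

text \<open>Convergence of Laurent series means that each initial segment of coefficients, including the infinitely
many of negative index, becomes stationary.\<close>
lemma tendsto_fls_iff:
  fixes f :: "'b \<Rightarrow> 'a::group_add fls"
  shows "(f \<longlongrightarrow> l) F \<longleftrightarrow> (\<forall>m::int. \<forall>\<^sub>F x in F. \<forall>j\<le>m. f x $$ j = l $$ j)"
proof (intro iffI allI)
  fix m :: int
  assume "(f \<longlongrightarrow> l) F"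
  then have "\<forall>\<^sub>F x in F. dist (f x) l < inverse (2 ^ nat m)" by (rule tendstoD) simp
  then show "\<forall>\<^sub>F x in F. \<forall>j\<le>m. f x $$ j = l $$ j"
    by eventually_elim (auto simp: dist_fls_less_iff)
next
  assume ev: "\<forall>m::int. \<forall>\<^sub>F x in F. \<forall>j\<le>m. f x $$ j = l $$ j"
  show "(f \<longlongrightarrow> l) F"
  proof (rule tendstoI)
    fix e :: real assume "e > 0"
    then obtain m where m: "inverse (2 ^ m) < e"
      by (metis reals_power_lt_ex one_less_numeral_iff semiring_norm(76) power_one_over inverse_eq_divide)
    show "\<forall>\<^sub>F x in F. dist (f x) l < e"
      using ev[rule_format, of "int m"]
    proof eventually_elim
      case (elim x)
      then show ?case using dist_fls_less_iff[of "f x" l m] m by simp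
    qed
  qed
qed

text \<open>This instance and the one for multiplication below make the general theory of unordered sums, in particular iterated sums and
multiplication by constants, applicable to Laurent series.\<close>
instance fls :: (ab_group_add) topological_comm_monoid_add
proof
  fix a b :: "'a fls"
  show "((\<lambda>x. fst x + snd x) \<longlongrightarrow> a + b) (nhds a \<times>\<^sub>F nhds b)"
    unfolding tendsto_fls_iff
  proof
    fix m :: int
    have fst: "\<forall>\<^sub>F x in nhds a \<times>\<^sub>F nhds b. \<forall>j\<le>m. fst x $$ j = a $$ j"
      using filterlim_fst[of "nhds a" "nhds b"] unfolding tendsto_fls_iff by blast
    have snd: "\<forall>\<^sub>F x in nhds a \<times>\<^sub>F nhds b. \<forall>j\<le>m. snd x $$ j = b $$ j"
      using filterlim_snd[of "nhds b" "nhds a"] unfolding tendsto_fls_iff by blast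
    show "\<forall>\<^sub>F x in nhds a \<times>\<^sub>F nhds b. \<forall>j\<le>m. (fst x + snd x) $$ j = (a + b) $$ j"
      using fst snd by eventually_elim auto
  qed
qed

text \<open>Unlike \<open>fls_subdegree\<close>, this treats the zero series as having infinite order, so that it is
stable under products without side conditions.\<close>
definition order_ge :: "int \<Rightarrow> 'a::zero fls \<Rightarrow> bool" where
  "order_ge d f \<longleftrightarrow> (\<forall>j<d. f $$ j = 0)"

lemma order_ge_mono: "order_ge d f \<Longrightarrow> d' \<le> d \<Longrightarrow> order_ge d' f"
  by (auto simp: order_ge_def)

lemma order_ge_0 [simp]: "order_ge d 0"
  by (simp add: order_ge_def)

lemma order_ge_add: "order_ge d f \<Longrightarrow> order_ge d g \<Longrightarrow> order_ge d (f + g)"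
  for f g :: "'a::monoid_add fls"
  by (simp add: order_ge_def)

lemma order_ge_imp_subdegree: "order_ge d f \<Longrightarrow> f \<noteq> 0 \<Longrightarrow> d \<le> fls_subdegree f"
  unfolding order_ge_def by (metis nth_fls_subdegree_nonzero not_le)

lemma order_ge_mult:
  fixes f g :: "'a::ring fls"
  assumes "order_ge d f" "order_ge e g"
  shows "order_ge (d + e) (f * g)"
proof (cases "f = 0 \<or> g = 0")
  case False
  then have "d \<le> fls_subdegree f" "e \<le> fls_subdegree g"
    using assms by (auto intro: order_ge_imp_subdegree)
  then show ?thesis
    unfolding order_ge_def by (auto intro!: fls_times_nth_eq0)
qed auto

lemma order_ge_power:
  fixes f :: "'a::ring_1 fls"
  assumes "order_ge d f"
  shows "order_ge (int n * d) (f ^ n)"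
proof (induction n)
  case (Suc n)
  then show ?case using order_ge_mult[OF assms Suc] by (simp add: algebra_simps)
qed (simp add: order_ge_def)

lemma fls_times_nth_cong:
  fixes a b f g :: "'a::ring fls"
  assumes "order_ge d a" "order_ge e b"
    and "\<forall>j\<le>m - e. f $$ j = a $$ j" "\<forall>j\<le>m - d. g $$ j = b $$ j"
    and "d + e \<le> m" "k \<le> m"
  shows "(f * g) $$ k = (a * b) $$ k"
proof -
  have f: "order_ge (m - e + 1) (f - a)" and g: "order_ge (m - d + 1) (g - b)"
    using assms(3,4) by (simp_all add: order_ge_def)
  have "order_ge (m + 1) ((f - a) * b)" "order_ge (m + 1) (a * (g - b))"
    using order_ge_mult[OF f assms(2)] order_ge_mult[OF assms(1) g] by simp_all
  moreover have "order_ge (m + 1) ((f - a) * (g - b))"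
    by (rule order_ge_mono[OF order_ge_mult[OF f g]]) (use assms(5) in simp)
  ultimately have "order_ge (m + 1) ((f - a) * b + a * (g - b) + (f - a) * (g - b))"
    by (intro order_ge_add)
  then have "order_ge (m + 1) (f * g - a * b)"
    by (simp add: algebra_simps)
  then show ?thesis
    using assms(6) by (simp add: order_ge_def)
qed

lemma order_ge_subdegree: "order_ge (fls_subdegree f) f"
  by (simp add: order_ge_def)

instance fls :: (ring) topological_semigroup_mult
proof
  fix a b :: "'a fls"
  show "((\<lambda>x. fst x * snd x) \<longlongrightarrow> a * b) (nhds a \<times>\<^sub>F nhds b)"
    unfolding tendsto_fls_iff
  proof
    fix m :: int
    define d e where "d = fls_subdegree a" and "e = fls_subdegree b"
    define M where "M = max m (d + e)"
    have fst: "\<forall>\<^sub>F x in nhds a \<times>\<^sub>F nhds b. \<forall>j\<le>M - e. fst x $$ j = a $$ j"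
      using filterlim_fst[of "nhds a" "nhds b"] unfolding tendsto_fls_iff by blast
    have snd: "\<forall>\<^sub>F x in nhds a \<times>\<^sub>F nhds b. \<forall>j\<le>M - d. snd x $$ j = b $$ j"
      using filterlim_snd[of "nhds b" "nhds a"] unfolding tendsto_fls_iff by blast
    show "\<forall>\<^sub>F x in nhds a \<times>\<^sub>F nhds b. \<forall>j\<le>m. (fst x * snd x) $$ j = (a * b) $$ j"
      using fst snd
      by eventually_elim
        (auto intro!: fls_times_nth_cong[where d = d and e = e and m = M] simp: d_def e_def M_def order_ge_subdegree)
  qed
qed

text \<open>Only finitely many members of the family reach a given coefficient, so each coefficient of the sum is a
finite sum.\<close>
lemma null_family_summable:
  fixes f :: "'i \<Rightarrow> 'a::ab_group_add fls"
  assumes f: "\<And>i. i \<in> I \<Longrightarrow> order_ge (int (w i)) (f i)"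
    and fin: "\<And>m. finite {i \<in> I. w i \<le> m}"
  shows "f summable_on I"
proof -
  define S where "S = fps_to_fls (Abs_fps (\<lambda>m. \<Sum>i | i \<in> I \<and> w i \<le> m. f i $$ int m))"
  have "\<forall>\<^sub>F J in finite_subsets_at_top I. \<forall>j\<le>m. sum f J $$ j = S $$ j" for m :: int
    unfolding eventually_finite_subsets_at_top
  proof (intro exI conjI allI impI)
    let ?K = "{i \<in> I. w i \<le> nat m}"
    show "finite ?K" "?K \<subseteq> I" using fin by auto
    fix J j assume J: "finite J \<and> ?K \<subseteq> J \<and> J \<subseteq> I" and j: "j \<le> m"
    have zero: "f i $$ j = 0" if "i \<in> J" "j < int (w i)" for i
      using f[of i] that J by (auto simp: order_ge_def)
    show "sum f J $$ j = S $$ j"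
    proof (cases "j < 0")
      case True
      then show ?thesis using zero by (simp add: S_def fls_nth_sum sum.neutral)
    next
      case False
      have "sum f J $$ j = (\<Sum>i\<in>J. f i $$ j)" by (simp add: fls_nth_sum)
      also have "\<dots> = (\<Sum>i | i \<in> I \<and> w i \<le> nat j. f i $$ j)"
      proof (rule sum.mono_neutral_right)
        show "\<forall>i\<in>J - {i \<in> I. w i \<le> nat j}. f i $$ j = 0"
          using J False by (auto intro!: zero simp: not_le nat_less_iff)
      qed (use J j in auto)
      finally show ?thesis using False by (simp add: S_def)
    qed
  qed
  then have "(f has_sum S) I"
    by (simp add: has_sum_def tendsto_fls_iff)
  then show ?thesis by (auto simp: summable_on_def)
qed

section \<open>Summation of the expansion\<close>

lemma has_sum_sum:
  fixes f :: "'i \<Rightarrow> 'j \<Rightarrow> 'a::topological_comm_monoid_add"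
  assumes "finite I" "\<And>i. i \<in> I \<Longrightarrow> (f i has_sum s i) J"
  shows "((\<lambda>j. \<Sum>i\<in>I. f i j) has_sum (\<Sum>i\<in>I. s i)) J"
  using assms by (induction I rule: finite_induct) (auto intro: has_sum_add)

lemma has_sum_shift:
  fixes f :: "nat \<Rightarrow> 'a::{comm_monoid_add, topological_space}"
  assumes "(f has_sum s) UNIV"
  shows "((\<lambda>n. if n < k then 0 else f (n - k)) has_sum s) UNIV"
proof -
  have "((\<lambda>n. f (n - k)) has_sum s) ((\<lambda>n. n + k) ` UNIV)"
    using assms by (subst has_sum_reindex) (auto simp: o_def inj_on_def)
  also have "(\<lambda>n. n + k) ` UNIV = {k..}"
    by (auto simp: image_iff intro: le_add_diff_inverse2[symmetric])
  also have "((\<lambda>n. f (n - k)) has_sum s) {k..} \<longleftrightarrow> ((\<lambda>n. if n < k then 0 else f (n - k)) has_sum s) UNIV"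
    by (rule has_sum_cong_neutral) auto
  finally show ?thesis .
qed

text \<open>Setting the variable of a formal series to 1 is compatible with multiplication by polynomials. This
avoids multiplying two convergent series, since all products that occur below have polynomial factors.\<close>
lemma has_sum_fps_mult_poly:
  fixes f :: "'a::{topological_comm_monoid_add, topological_semigroup_mult, comm_ring_1} fps"
  assumes "((\<lambda>n. f $ n) has_sum s) UNIV"
  shows "((\<lambda>n. (f * fps_of_poly q) $ n) has_sum s * poly q 1) UNIV"
proof (induction q)
  case 0
  then show ?case by simp
next
  case (pCons a q)
  have "((\<lambda>n. (if n < 1 then 0 else (f * fps_of_poly q) $ (n - 1)) + f $ n * a) has_sum (s * poly q 1 + s * a)) UNIV"
    by (intro has_sum_add has_sum_shift has_sum_cmult_left assms pCons.IH)
  also have "(\<lambda>n. (if n < 1 then 0 else (f * fps_of_poly q) $ (n - 1)) + f $ n * a) = (\<lambda>n. (f * fps_of_poly (pCons a q)) $ n)"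
  proof
    fix n
    have "f * fps_of_poly (pCons a q) = fps_X * (f * fps_of_poly q) + f * fps_const a"
      by (simp add: fps_of_poly_pCons algebra_simps)
    then show "(if n < 1 then 0 else (f * fps_of_poly q) $ (n - 1)) + f $ n * a = (f * fps_of_poly (pCons a q)) $ n"
      by auto
  qed
  finally show ?case by (simp add: algebra_simps)
qed

lemma has_sum_fps_of_poly:
  fixes q :: "'a::{topological_comm_monoid_add, topological_semigroup_mult, comm_ring_1} poly"
  shows "((\<lambda>n. fps_of_poly q $ n) has_sum poly q 1) UNIV"
proof -
  have "((\<lambda>n. (1 :: 'a fps) $ n) has_sum 1) UNIV"
    by (rule has_sum_finite_neutralI[of "{0}"]) auto
  from has_sum_fps_mult_poly[OF this, of q] show ?thesis by simp
qed

lemma has_sum_fps_quotient: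
  fixes f :: "'a::{topological_comm_monoid_add, topological_semigroup_mult, t2_space, comm_ring_1} fps"
  assumes "((\<lambda>n. f $ n) has_sum s) UNIV" "f * fps_of_poly q = fps_of_poly r"
  shows "s * poly q 1 = poly r 1"
  using has_sum_fps_mult_poly[OF assms(1), of q] has_sum_fps_of_poly[of r] assms(2)
  by (metis has_sum_unique)

lemma summable_fls_by_order:
  fixes f :: "nat \<Rightarrow> 'a::ab_group_add fls"
  assumes "\<And>n. order_ge (int n) (f n)"
  shows "f summable_on UNIV"
  by (rule null_family_summable[where w = "\<lambda>n. n"]) (use assms in auto)

lemma order_ge_1_nth: "order_ge 1 f \<Longrightarrow> f $$ 0 = 0"
  by (simp add: order_ge_def)

lemma one_minus_order_ge_1_nonzero:
  fixes t :: "'a::ring_1 fls"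
  assumes "order_ge 1 t"
  shows "1 - t \<noteq> 0"
proof
  assume "1 - t = 0"
  then have "(1 - t) $$ 0 = 0" by simp
  then show False using order_ge_1_nth[OF assms] by simp
qed

locale fls_real_scalars = real_scalars \<rho> for \<rho> :: "real \<Rightarrow> 'b::field_char_0 fls" +
  assumes order_scalar: "order_ge 0 (\<rho> a)"
begin

text \<open>The negative binomial series. The case \<open>M = 0\<close> is included, where the upper entry
\<open>j - 1\<close> is negative for \<open>j = 0\<close>; there the binomial coefficient is still 1.\<close>
lemma has_sum_neg_binomial:
  assumes t: "order_ge 1 t"
  shows "((\<lambda>j. \<rho> (ibinom (int M + int j - 1) (int j)) * t ^ j) has_sum inverse (1 - t) ^ M) UNIV"
proof -
  define f where "f = Abs_fps (\<lambda>j. \<rho> (ibinom (int M + int j - 1) (int j)) * t ^ j)"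
  have "order_ge (int j) (f $ j)" for j
    using order_ge_mult[OF order_scalar order_ge_power[OF t, of j]] by (simp add: f_def)
  then obtain s where s: "((\<lambda>j. f $ j) has_sum s) UNIV"
    using summable_fls_by_order[of "\<lambda>j. f $ j"] by (auto simp: summable_on_def)
  have "f = inverse ((1 - fps_const t * fps_X) ^ M)"
  proof (cases "M = 0")
    case True
    have "f $ j = 1 $ j" for j
    proof (cases j)
      case (Suc i)
      then have "ibinom (int M + int j - 1) (int j) = real (i choose Suc i)"
        using True ibinom_of_nat[of i "Suc i"] by simp
      then show ?thesis by (simp add: f_def Suc)
    qed (simp add: f_def ibinom_def one)
    then show ?thesis using True by (simp add: fps_eq_iff)
  next
    case False
    have "\<rho> (ibinom (int M + int j - 1) (int j)) = of_nat ((M + j - 1) choose j)" for j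
    proof -
      have "int M + int j - 1 = int (M + j - 1)" using False by simp
      then show ?thesis by (simp only: ibinom_of_nat of_nat)
    qed
    then show ?thesis using False by (simp add: f_def one_minus_const_fps_X_neg_power')
  qed
  then have "f * (1 - fps_const t * fps_X) ^ M = 1"
    by (simp add: inverse_mult_eq_1 fps_nth_power_0)
  also have "(1 - fps_const t * fps_X) = fps_of_poly [:1, - t:]"
    by (simp add: fps_of_poly_pCons fps_const_neg[symmetric] mult.commute del: fps_const_neg)
  finally have "f * fps_of_poly ([:1, - t:] ^ M) = fps_of_poly 1"
    by (simp add: fps_of_poly_power)
  from has_sum_fps_quotient[OF s this] have "s * (1 - t) ^ M = 1" by simp
  moreover have "1 - t \<noteq> 0" using t by (rule one_minus_order_ge_1_nonzero)
  ultimately have "s = inverse (1 - t) ^ M"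
    by (simp add: power_inverse[symmetric] field_simps)
  with s show ?thesis by (simp add: f_def)
qed

text \<open>Summation over the exponent of \<open>t\<close> is where \<open>z = t / (1 - t)\<close> comes from.\<close>
lemma has_sum_neg_binomial_shift:
  assumes t: "order_ge 1 t"
  shows "((\<lambda>m. t ^ m * \<rho> (ibinom (int N + int m - 1) (int m - int k)))
     has_sum (inverse (1 - t) ^ N * (t / (1 - t)) ^ k)) UNIV"
proof -
  let ?g = "\<lambda>j. \<rho> (ibinom (int (N + k) + int j - 1) (int j)) * t ^ j"
  have "((\<lambda>m. t ^ k * (if m < k then 0 else ?g (m - k))) has_sum (t ^ k * inverse (1 - t) ^ (N + k))) UNIV"
    by (intro has_sum_cmult_right has_sum_shift has_sum_neg_binomial t)
  also have "(\<lambda>m. t ^ k * (if m < k then 0 else ?g (m - k))) = (\<lambda>m. t ^ m * \<rho> (ibinom (int N + int m - 1) (int m - int k)))"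
  proof
    fix m
    show "t ^ k * (if m < k then 0 else ?g (m - k)) = t ^ m * \<rho> (ibinom (int N + int m - 1) (int m - int k))"
    proof (cases "m < k")
      case True
      then show ?thesis by (simp add: ibinom_def)
    next
      case False
      then have "t ^ m = t ^ k * t ^ (m - k)" by (simp flip: power_add)
      then show ?thesis using False by (simp add: of_nat_diff algebra_simps)
    qed
  qed
  finally show ?thesis by (simp add: power_add field_simps)
qed

end

lemma card_diagram: "card (diagram \<mu>) = sum_list \<mu>"
proof -
  have "diagram \<mu> = Sigma {1..length \<mu>} (\<lambda>i. {1..\<mu> ! (i - 1)})"
    by (auto simp: diagram_def)
  then have "card (diagram \<mu>) = (\<Sum>i=1..length \<mu>. \<mu> ! (i - 1))"
    by simp
  also have "\<dots> = (\<Sum>i<length \<mu>. \<mu> ! i)"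
    by (rule sum.reindex_bij_witness[of _ Suc "\<lambda>i. i - 1"]) auto
  finally show ?thesis by (simp add: sum_list_sum_nth atLeast0LessThan)
qed

context fls_real_scalars
begin

text \<open>The contribution of a cell of content \<open>c\<close> to the left-hand side, written with
\<open>u = -1/x\<close>, \<open>v = -1/(x+y+1)\<close> and \<open>t = -y/(x(x+y+1))\<close>.\<close>
definition cell_factor :: "'b fls \<Rightarrow> 'b fls \<Rightarrow> 'b fls \<Rightarrow> real \<Rightarrow> 'b fls" where
  "cell_factor u v t c = (1 - u * \<rho> c) * (1 - v * \<rho> c) / ((1 - u * \<rho> c) * (1 - v * \<rho> c) - t)"

text \<open>The family indexed by \<open>(m, p, q)\<close> is summable. Summing it over \<open>(p, q)\<close> first gives the claimed
iterated sum; summing it over \<open>m\<close> first gives \<open>(1 - t)\<^bsup>-N\<^esup>\<close> times the generating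
function of \<open>F_fun\<close>, whose value at 1 is the quotient found in \<open>cycle_sum_cells\<close>.\<close>
lemma cell_product_expansion:
  fixes \<alpha> :: real and lam :: "nat list"
  assumes u: "order_ge 1 u" and v: "order_ge 1 v" and t: "order_ge 1 t"
  defines "B \<equiv> (\<lambda>m (p, q). u ^ p * v ^ q * \<rho> (\<Sum>k = 0..min m (p + q).
       ibinom (int (sum_list lam) + int m - 1) (int m - int k) * F_fun \<alpha> (p + q) p k lam))"
  shows "B m summable_on UNIV"
    and "((\<lambda>m. t ^ m * infsum (B m) UNIV) has_sum (\<Prod>(i, j)\<in>diagram lam. cell_factor u v t (content \<alpha> i j))) UNIV"
proof -
  define N where "N = sum_list lam"
  define z where "z = t / (1 - t)"
  define T where "T = (\<lambda>(m, pq). t ^ m * B m pq)"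
  define \<beta> where "\<beta> = (\<lambda>(p, q). u ^ p * v ^ q * (\<Sum>k\<le>p + q. \<rho> (F_fun \<alpha> (p + q) p k lam) * z ^ k))"
  define H where "H = cycle_sum (\<lambda>n. \<rho> (d_pow \<alpha> lam n) * binom_k_sum u v z n)"

  have nz: "1 - t \<noteq> 0" using t by (rule one_minus_order_ge_1_nonzero)
  have uv: "order_ge (int (p + q)) (u ^ p * v ^ q * f)" if "order_ge 0 f" for p q f
    using order_ge_mult[OF order_ge_mult[OF order_ge_power[OF u, of p] order_ge_power[OF v, of q]] that] by simp
  have ordB: "order_ge (int (p + q)) (B m (p, q))" for m p q
    unfolding B_def by (simp only: prod.case) (rule uv[OF order_scalar])
  have finpq: "finite {pq :: nat \<times> nat. fst pq + snd pq \<le> m}" for m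
    by (rule finite_subset[of _ "{..m} \<times> {..m}"]) auto
  show "B m summable_on UNIV" for m
    by (rule null_family_summable[where w = "\<lambda>pq. fst pq + snd pq"]) (use ordB finpq in auto)
  then have sumB: "(B m has_sum infsum (B m) UNIV) UNIV" for m
    by (simp add: summable_iff_has_sum_infsum)

  have "order_ge (int (m + (p + q))) (T (m, (p, q)))" for m p q
    using order_ge_mult[OF order_ge_power[OF t, of m] ordB[of p q m]] by (simp add: T_def)
  then have "T summable_on UNIV"
  proof (intro null_family_summable[where w = "\<lambda>mpq. fst mpq + (fst (snd mpq) + snd (snd mpq))"])
    fix m :: nat
    show "finite {mpq \<in> UNIV. fst mpq + (fst (snd mpq) + snd (snd mpq)) \<le> m}"
      by (rule finite_subset[of _ "{..m} \<times> {..m} \<times> {..m}"]) auto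
  qed auto
  then obtain S where S: "(T has_sum S) (UNIV \<times> UNIV)"
    by (auto simp: summable_on_def)
  have "((\<lambda>m. t ^ m * infsum (B m) UNIV) has_sum S) UNIV"
    by (rule has_sum_SigmaD[OF S]) (auto simp: T_def intro: has_sum_cmult_right sumB)

  \<comment> \<open>The other order of summation: \<open>m\<close> first, for fixed \<open>(p, q)\<close>.\<close>
  have "((\<lambda>pq. inverse (1 - t) ^ N * \<beta> pq) has_sum S) UNIV"
  proof (rule has_sum_SigmaD[OF S[unfolded has_sum_swap[of T]]])
    fix pq :: "nat \<times> nat"
    obtain p q where pq: "pq = (p, q)" by (cases pq)
    let ?F = "\<lambda>k. \<rho> (F_fun \<alpha> (p + q) p k lam)"
    have "((\<lambda>m. \<Sum>k\<le>p + q. u ^ p * v ^ q * ?F k * (t ^ m * \<rho> (ibinom (int N + int m - 1) (int m - int k))))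
      has_sum (\<Sum>k\<le>p + q. u ^ p * v ^ q * ?F k * (inverse (1 - t) ^ N * z ^ k))) UNIV"
      unfolding z_def by (intro has_sum_sum has_sum_cmult_right has_sum_neg_binomial_shift t) simp
    also have "(\<lambda>m. \<Sum>k\<le>p + q. u ^ p * v ^ q * ?F k * (t ^ m * \<rho> (ibinom (int N + int m - 1) (int m - int k))))
       = (\<lambda>m. case (pq, m) of (x, y) \<Rightarrow> T (y, x))"
    proof
      fix m
      have "(\<Sum>k\<le>p + q. u ^ p * v ^ q * ?F k * (t ^ m * \<rho> (ibinom (int N + int m - 1) (int m - int k))))
        = (\<Sum>k = 0..min m (p + q). u ^ p * v ^ q * ?F k * (t ^ m * \<rho> (ibinom (int N + int m - 1) (int m - int k))))"
        by (rule sum.mono_neutral_right) (auto simp: ibinom_def)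
      also have "\<dots> = T (m, pq)"
        by (simp add: T_def B_def pq sum mult N_def sum_distrib_left) (simp only: ac_simps)
      finally show "(\<Sum>k\<le>p + q. u ^ p * v ^ q * ?F k * (t ^ m * \<rho> (ibinom (int N + int m - 1) (int m - int k))))
       = (case (pq, m) of (x, y) \<Rightarrow> T (y, x))" by simp
    qed
    also have "(\<Sum>k\<le>p + q. u ^ p * v ^ q * ?F k * (inverse (1 - t) ^ N * z ^ k)) = inverse (1 - t) ^ N * \<beta> pq"
      by (simp add: \<beta>_def pq sum_distrib_left) (simp only: ac_simps)
    finally show "((\<lambda>m. case (pq, m) of (x, y) \<Rightarrow> T (y, x)) has_sum inverse (1 - t) ^ N * \<beta> pq) UNIV" .
  qed
  then have "((\<lambda>pq. (1 - t) ^ N * (inverse (1 - t) ^ N * \<beta> pq)) has_sum (1 - t) ^ N * S) UNIV"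
    by (rule has_sum_cmult_right)
  then have \<beta>: "(\<beta> has_sum (1 - t) ^ N * S) UNIV"
    using nz by (simp add: power_inverse[symmetric] field_simps)

  \<comment> \<open>Collecting the terms of total degree \<open>n = p + q\<close> gives the coefficients of \<open>cycle_sum\<close>.\<close>
  have "(\<beta> has_sum (1 - t) ^ N * S) UNIV \<longleftrightarrow>
     ((\<lambda>(n, p). \<beta> (p, n - p)) has_sum (1 - t) ^ N * S) (Sigma UNIV (\<lambda>n. {..n}))"
    by (rule has_sum_reindex_bij_witness[of _ "\<lambda>(n, p). (p, n - p)" "\<lambda>(p, q). (p + q, p)"]) auto
  with \<beta> have \<beta>': "((\<lambda>(n, p). \<beta> (p, n - p)) has_sum (1 - t) ^ N * S) (Sigma UNIV (\<lambda>n. {..n}))" by simp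
  have "(H has_sum (1 - t) ^ N * S) UNIV"
  proof (rule has_sum_SigmaD[OF \<beta>'])
    fix n
    have "(\<Sum>p\<le>n. \<beta> (p, n - p)) = H n"
      by (simp add: H_def F_fun_series[symmetric] \<beta>_def sum_distrib_left) (simp only: ac_simps)
    then show "((\<lambda>p. case (n, p) of (n, p) \<Rightarrow> \<beta> (p, n - p)) has_sum H n) {..n}"
      by (intro has_sum_finiteI) simp_all
  qed
  then have Hsum: "((\<lambda>n. Abs_fps H $ n) has_sum (1 - t) ^ N * S) UNIV" by simp

  \<comment> \<open>The polynomials \<open>PD\<close> and \<open>PP\<close> have the values \<open>D\<close> and \<open>(D - t) / (1 - t)\<close> at 1.\<close>
  define D where "D = (\<lambda>(i, j). (1 - u * \<rho> (content \<alpha> i j)) * (1 - v * \<rho> (content \<alpha> i j)))"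
  define PD where "PD = (\<lambda>(i, j). [:1, - (\<rho> (content \<alpha> i j) * u):] * [:1, - (\<rho> (content \<alpha> i j) * v):])"
  define PP where "PP = (\<lambda>s. smult (1 + z) (PD s) - [:z:])"
  have lin: "fps_of_poly [:1, - a:] = 1 - fps_const a * fps_X" for a :: "'b fls"
    by (simp add: fps_of_poly_pCons fps_const_neg[symmetric] mult.commute del: fps_const_neg)
  have PD: "cell_poly (\<rho> (content \<alpha> i j) * u) (\<rho> (content \<alpha> i j) * v) = fps_of_poly (PD (i, j))" for i j
    by (simp only: PD_def prod.case fps_of_poly_mult lin cell_poly_def)
  have PP: "cell_den (\<rho> (content \<alpha> i j) * u) (\<rho> (content \<alpha> i j) * v) z = fps_of_poly (PP (i, j))" for i j
    by (simp only: cell_den_def PP_def PD fps_of_poly_diff fps_of_poly_smult fps_of_poly_const)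
  have "(\<Sum>s\<in>diagram lam. (case s of (i, j) \<Rightarrow> \<rho> (content \<alpha> i j)) ^ n) = \<rho> (d_pow \<alpha> lam n)" for n
    by (simp add: d_pow_def sum power case_prod_beta)
  then have "H = cycle_sum (\<lambda>n. (\<Sum>s\<in>diagram lam. (case s of (i, j) \<Rightarrow> \<rho> (content \<alpha> i j)) ^ n) * binom_k_sum u v z n)"
    by (simp add: H_def)
  then have "Abs_fps H * fps_of_poly (prod PP (diagram lam)) = fps_of_poly (prod PD (diagram lam))"
    using cycle_sum_cells[OF finite_diagram[of lam],
      where c = "\<lambda>(i, j). \<rho> (content \<alpha> i j)" and u = u and v = v and z = z]
    by (simp add: case_prod_beta PD PP fps_of_poly_prod)
  from has_sum_fps_quotient[OF Hsum this]
  have main: "(1 - t) ^ N * S * (\<Prod>s\<in>diagram lam. poly (PP s) 1) = (\<Prod>s\<in>diagram lam. poly (PD s) 1)"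
    by (simp add: poly_prod)
  have PD1: "poly (PD s) 1 = D s" for s
    by (simp add: PD_def D_def case_prod_beta algebra_simps)
  have PP1: "(1 - t) * poly (PP s) 1 = D s - t" for s
  proof -
    have z: "(1 - t) * z = t" using nz by (simp add: z_def)
    have "(1 - t) * poly (PP s) 1 = (1 - t) * D s + (1 - t) * z * D s - (1 - t) * z"
      by (simp add: PP_def PD1 algebra_simps)
    then show ?thesis unfolding z by (simp add: algebra_simps)
  qed
  have Dt: "D s - t \<noteq> 0" for s
  proof -
    obtain i j where s: "s = (i, j)" by (cases s)
    let ?c = "\<rho> (content \<alpha> i j)"
    have "order_ge 1 (u * ?c)" "order_ge 1 (v * ?c)"
      using order_ge_mult[OF u order_scalar[of "content \<alpha> i j"]] order_ge_mult[OF v order_scalar[of "content \<alpha> i j"]] by simp_all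
    moreover from this have "order_ge 1 (u * ?c * (v * ?c))"
      using order_ge_mult order_ge_mono by fastforce
    ultimately have "(D s - t) $$ 0 = 1"
      using t by (simp add: D_def s algebra_simps order_ge_1_nth)
    then show ?thesis by auto
  qed
  have "(\<Prod>s\<in>diagram lam. D s - t) = (\<Prod>s\<in>diagram lam. (1 - t) * poly (PP s) 1)"
    by (simp only: PP1)
  also have "\<dots> = (1 - t) ^ N * (\<Prod>s\<in>diagram lam. poly (PP s) 1)"
    by (simp add: prod.distrib card_diagram N_def)
  finally have "S * (\<Prod>s\<in>diagram lam. D s - t) = (\<Prod>s\<in>diagram lam. D s)"
    using main by (simp add: PD1 ac_simps)
  moreover have "(\<Prod>s\<in>diagram lam. D s - t) \<noteq> 0"
    using Dt finite_diagram by (simp add: prod_zero_iff)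
  ultimately have "S = (\<Prod>s\<in>diagram lam. D s) / (\<Prod>s\<in>diagram lam. D s - t)"
    by (simp add: field_simps)
  also have "\<dots> = (\<Prod>s\<in>diagram lam. D s / (D s - t))"
    by (simp add: prod_dividef)
  finally have "S = (\<Prod>(i, j)\<in>diagram lam. cell_factor u v t (content \<alpha> i j))"
    by (simp add: D_def cell_factor_def case_prod_beta)
  with \<open>((\<lambda>m. t ^ m * infsum (B m) UNIV) has_sum S) UNIV\<close>
  show "((\<lambda>m. t ^ m * infsum (B m) UNIV) has_sum (\<Prod>(i, j)\<in>diagram lam. cell_factor u v t (content \<alpha> i j))) UNIV"
    by simp
qed

end

section \<open>Series with polynomial coefficients and the expansion in \<open>1/x\<close>\<close>

lemma poly_coeff_order: "f \<in> poly_coeff_series \<Longrightarrow> order_ge 0 f"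
  by (simp add: poly_coeff_series_def order_ge_def)

text \<open>Membership in \<open>poly_coeff_series\<close> is reduced to formal power series, whose products and inverses have
simple coefficient formulas.\<close>
lemma poly_coeff_iff_fps:
  "f \<in> poly_coeff_series \<longleftrightarrow> (\<exists>g. f = fps_to_fls g \<and> (\<forall>n. g $ n \<in> range to_fract))"
proof
  assume f: "f \<in> poly_coeff_series"
  have "f = fps_to_fls (fls_regpart f)"
    by (rule fls_eqI) (use f in \<open>auto simp: poly_coeff_series_def\<close>)
  moreover have "\<forall>n. fls_regpart f $ n \<in> range to_fract"
    using f by (simp add: poly_coeff_series_def)
  ultimately show "\<exists>g. f = fps_to_fls g \<and> (\<forall>n. g $ n \<in> range to_fract)" by blast
next
  assume "\<exists>g. f = fps_to_fls g \<and> (\<forall>n. g $ n \<in> range to_fract)"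
  then show "f \<in> poly_coeff_series"
    by (auto simp: poly_coeff_series_def intro: range_eqI[where x = 0])
qed

lemma range_to_fract_closed:
  fixes a b :: "'a::idom fract"
  shows "a \<in> range to_fract \<Longrightarrow> b \<in> range to_fract \<Longrightarrow> a * b \<in> range to_fract"
    and "a \<in> range to_fract \<Longrightarrow> b \<in> range to_fract \<Longrightarrow> a + b \<in> range to_fract"
    and "a \<in> range to_fract \<Longrightarrow> - a \<in> range to_fract"
    and "(\<And>i. i \<in> I \<Longrightarrow> f i \<in> range (to_fract :: 'a \<Rightarrow> _)) \<Longrightarrow> sum f I \<in> range to_fract"
proof -
  show mult: "a \<in> range to_fract \<Longrightarrow> b \<in> range to_fract \<Longrightarrow> a * b \<in> range to_fract"
    and add: "a \<in> range to_fract \<Longrightarrow> b \<in> range to_fract \<Longrightarrow> a + b \<in> range to_fract" for a b :: "'a fract"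
    by (auto simp flip: to_fract_mult to_fract_add)
  show "a \<in> range to_fract \<Longrightarrow> - a \<in> range to_fract"
    by (auto simp flip: to_fract_uminus)
  show "(\<And>i. i \<in> I \<Longrightarrow> f i \<in> range (to_fract :: 'a \<Rightarrow> _)) \<Longrightarrow> sum f I \<in> range to_fract"
    by (induction I rule: infinite_finite_induct) (auto intro: add range_eqI[of 0 to_fract 0])
qed

lemma poly_coeff_add: "f \<in> poly_coeff_series \<Longrightarrow> g \<in> poly_coeff_series \<Longrightarrow> f + g \<in> poly_coeff_series"
  by (simp add: poly_coeff_series_def range_to_fract_closed)

lemma poly_coeff_minus: "f \<in> poly_coeff_series \<Longrightarrow> - f \<in> poly_coeff_series"
  by (simp add: poly_coeff_series_def range_to_fract_closed)

lemma poly_coeff_mult: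
  assumes "f \<in> poly_coeff_series" "g \<in> poly_coeff_series"
  shows "f * g \<in> poly_coeff_series"
proof -
  from assms obtain f' g' where fg: "f = fps_to_fls f'" "g = fps_to_fls g'"
    and "\<And>n. f' $ n \<in> range to_fract" "\<And>n. g' $ n \<in> range to_fract"
    unfolding poly_coeff_iff_fps by blast
  then have "(f' * g') $ n \<in> range to_fract" for n
    by (auto simp: fps_mult_nth intro!: range_to_fract_closed)
  then show ?thesis
    unfolding poly_coeff_iff_fps fg fls_times_fps_to_fls[symmetric] by blast
qed

lemma poly_coeff_const: "fls_const (to_fract a) \<in> poly_coeff_series"
  by (auto simp: poly_coeff_series_def intro: range_eqI[where x = 0])

lemma poly_coeff_1: "1 \<in> poly_coeff_series"
  using poly_coeff_const[of 1] by simp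

lemma poly_coeff_const_xy: "const_xy a \<in> poly_coeff_series"
  unfolding const_xy_def by (rule poly_coeff_const)

lemma poly_coeff_y: "y_xy \<in> poly_coeff_series"
  unfolding y_xy_def by (rule poly_coeff_const)

lemma poly_coeff_X: "fls_X \<in> poly_coeff_series"
  using range_eqI[of _ to_fract "0 :: real poly"] range_eqI[of _ to_fract "1 :: real poly"]
  by (auto simp: poly_coeff_series_def)

lemma poly_coeff_power: "f \<in> poly_coeff_series \<Longrightarrow> f ^ n \<in> poly_coeff_series"
  by (induction n) (auto intro: poly_coeff_1 poly_coeff_mult)

lemma poly_coeff_prod: "(\<And>i. i \<in> I \<Longrightarrow> f i \<in> poly_coeff_series) \<Longrightarrow> prod f I \<in> poly_coeff_series"
  by (induction I rule: infinite_finite_induct) (auto intro: poly_coeff_1 poly_coeff_mult)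

text \<open>With constant coefficient 1, the recursion for the coefficients of the inverse needs no division.\<close>
lemma poly_coeff_inverse:
  assumes "f \<in> poly_coeff_series" "f $$ 0 = 1"
  shows "inverse f \<in> poly_coeff_series"
proof -
  obtain g where f: "f = fps_to_fls g" and g: "g $ n \<in> range to_fract" for n
    using assms(1) by (auto simp: poly_coeff_iff_fps)
  have g0: "g $ 0 = 1" using assms(2) by (simp add: f)
  have inv: "g * inverse g = 1" using inverse_mult_eq_1'[of g] g0 by simp
  have "inverse g $ n \<in> range to_fract" for n
  proof (induction n rule: less_induct)
    case (less n)
    show ?case
    proof (cases "n = 0")
      case True
      then show ?thesis using g0 by (auto intro: range_eqI[where x = 1])
    next
      case False
      have "(\<Sum>i=0..n. g $ i * inverse g $ (n - i)) = 0"
        using False inv by (metis fps_mult_nth fps_one_nth)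
      then have "inverse g $ n = - (\<Sum>i=1..n. g $ i * inverse g $ (n - i))"
        by (simp add: sum.atLeast_Suc_atMost g0 eq_neg_iff_add_eq_0)
      also have "\<dots> \<in> range to_fract"
        using less g False by (intro range_to_fract_closed) auto
      finally show ?thesis .
    qed
  qed
  moreover have "inverse f = fps_to_fls (inverse g)"
  proof -
    have "f * fps_to_fls (inverse g) = 1" by (simp add: f inv flip: fls_times_fps_to_fls)
    then show ?thesis by (rule inverse_unique)
  qed
  ultimately show ?thesis unfolding poly_coeff_iff_fps by blast
qed

interpretation xy: fls_real_scalars const_xy
proof
  show "const_xy (a + b) = const_xy a + const_xy b" for a b
    by (rule fls_eqI) (simp add: const_xy_def flip: to_fract_add)
  show "const_xy (a * b) = const_xy a * const_xy b" for a b
    by (simp add: const_xy_def mult.commute flip: to_fract_mult)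
  show "const_xy 1 = 1"
    by (simp add: const_xy_def flip: one_pCons)
  show "order_ge 0 (const_xy a)" for a
    by (rule poly_coeff_order[OF poly_coeff_const_xy])
qed

theorem theorem5p1:
  fixes \<alpha> :: real and lam :: "nat list"
    and L :: xy_series and A :: "nat \<Rightarrow> xy_series" and B :: "nat \<Rightarrow> nat \<times> nat \<Rightarrow> xy_series"
  assumes "\<alpha> > 0" and "is_partition lam"
  defines "L \<equiv> rising \<alpha> (x_xy + y_xy + 1) lam / rising \<alpha> (x_xy + y_xy) lam
                * (rising \<alpha> x_xy lam / rising \<alpha> (x_xy + 1) lam)"
    and "A \<equiv> \<lambda>n. (- y_xy / x_xy ^ 2) ^ n * (1 + (y_xy + 1) / x_xy) powi (- int n)"
    and "B \<equiv> \<lambda>n (p, q). (- 1 / x_xy) ^ (p + q) * (1 + (y_xy + 1) / x_xy) powi (- int q)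
                * const_xy (\<Sum>k = 0..min n (p + q).
                    ibinom (int (sum_list lam) + int n - 1) (int n - int k)
                    * F_fun \<alpha> (p + q) p k lam)"
  shows "L \<in> poly_coeff_series
    \<and> (\<forall>n. A n \<in> poly_coeff_series \<and> range (B n) \<subseteq> poly_coeff_series
           \<and> B n summable_on UNIV)
    \<and> ((\<lambda>n. A n * infsum (B n) UNIV) has_sum L) UNIV"
proof -
  \<comment> \<open>The variable is \<open>X = 1/x\<close>, and \<open>e = (x + y + 1) / x\<close> is a unit with constant coefficient 1.\<close>
  define X where "X = (fls_X :: xy_series)"
  define e where "e = 1 + (y_xy + 1) * X"
  define u where "u = - X"
  define v where "v = - X * inverse e"
  define t where "t = - y_xy * X ^ 2 * inverse e"
  have Xx: "X * x_xy = 1" by (simp add: X_def x_xy_def fls_X_times_conv_shift)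
  have x0: "x_xy \<noteq> 0" using Xx by auto
  have inv_x: "1 / x_xy = X" using Xx x0 by (simp add: field_simps)
  have e_eq: "1 + (y_xy + 1) / x_xy = e"
    unfolding e_def inv_x[symmetric] by simp
  note closed = poly_coeff_add poly_coeff_minus poly_coeff_mult poly_coeff_power poly_coeff_prod
    poly_coeff_1 poly_coeff_const_xy poly_coeff_y
  have X: "X \<in> poly_coeff_series" unfolding X_def by (rule poly_coeff_X)
  have unit: "1 + f * X \<in> poly_coeff_series" "(1 + f * X) $$ 0 = 1" "inverse (1 + f * X) \<in> poly_coeff_series"
    if "f \<in> poly_coeff_series" for f
  proof -
    show "1 + f * X \<in> poly_coeff_series" by (intro closed X that)
    moreover show "(1 + f * X) $$ 0 = 1"
      using poly_coeff_order[OF that] by (simp add: X_def fls_X_times_conv_shift order_ge_def)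
    ultimately show "inverse (1 + f * X) \<in> poly_coeff_series" by (rule poly_coeff_inverse)
  qed
  have ie: "inverse e \<in> poly_coeff_series" unfolding e_def by (intro unit closed)
  have ord_X: "order_ge 1 (X * f)" if "f \<in> poly_coeff_series" for f
    using order_ge_mult[of 1 X 0 f] poly_coeff_order[OF that] by (simp add: X_def order_ge_def)
  have u: "order_ge 1 u" using ord_X[of "- 1"] by (simp add: u_def closed)
  have v: "order_ge 1 v" using ord_X[of "- inverse e"] ie by (simp add: v_def closed)
  have t: "order_ge 1 t" using ord_X[of "- y_xy * X * inverse e"] ie X
    by (simp add: t_def closed power2_eq_square mult_ac)
  have "- y_xy / x_xy ^ 2 * inverse e = t"
    by (simp add: t_def divide_inverse power_inverse flip: inv_x)
  from this[symmetric] have A: "A n = t ^ n" for n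
    by (simp only: A_def e_eq power_int_minus power_int_of_nat power_mult_distrib power_inverse)
  have B: "B n = (\<lambda>(p, q). u ^ p * v ^ q * const_xy (\<Sum>k = 0..min n (p + q).
                    ibinom (int (sum_list lam) + int n - 1) (int n - int k)
                    * F_fun \<alpha> (p + q) p k lam))" for n
  proof -
    have "(- 1 / x_xy) ^ (p + q) * e powi (- int q) = u ^ p * v ^ q" for p q
    proof -
      have "- 1 / x_xy = u" using inv_x by (simp add: u_def)
      moreover have "v = u * inverse e" by (simp add: u_def v_def)
      ultimately show ?thesis
        by (simp add: power_int_minus power_mult_distrib power_inverse power_add)
    qed
    then show ?thesis unfolding B_def e_eq by simp
  qed
  have uvpc: "u \<in> poly_coeff_series" "v \<in> poly_coeff_series" "t \<in> poly_coeff_series"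
    unfolding u_def v_def t_def by (intro closed X ie)+
  have nz: "x_xy + f \<noteq> 0" if "f \<in> poly_coeff_series" for f
  proof
    assume "x_xy + f = 0"
    then have "X * (x_xy + f) = 0" by simp
    then have "1 + f * X = 0" using Xx by (simp add: algebra_simps)
    then show False using unit(2)[OF that] by simp
  qed
  \<comment> \<open>Here \<open>D = (x + c) (x + y + 1 + c) / (x (x + y + 1))\<close>, and the numerator of \<open>D - t\<close> is
    \<open>(x + c) (x + y + 1 + c) + y = (x + y + c) (x + 1 + c)\<close>.\<close>
  have factor: "xy.cell_factor u v t c
      = (x_xy + y_xy + 1 + const_xy c) / (x_xy + y_xy + const_xy c) * ((x_xy + const_xy c) / (x_xy + 1 + const_xy c))" for c
  proof -
    define k where "k = const_xy c"
    have k: "k \<in> poly_coeff_series" unfolding k_def by (intro closed)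
    define w where "w = x_xy + y_xy + 1"
    have w: "w \<noteq> 0" unfolding w_def add.assoc by (intro nz closed)
    have "e = w * X" using Xx by (simp add: e_def w_def algebra_simps)
    then have v_eq: "v = - 1 / w" and t_eq: "t = - y_xy * X / w"
      using w x0 by (simp_all add: v_def t_def power2_eq_square flip: inv_x)
    have num: "(1 - u * k) * (1 - v * k) = (x_xy + k) * (w + k) / (x_xy * w)"
      using w x0 by (simp add: u_def v_eq field_simps flip: inv_x)
    have "(1 - u * k) * (1 - v * k) - t = ((x_xy + k) * (w + k) + y_xy) / (x_xy * w)"
      unfolding num using w x0 by (simp add: t_eq field_simps flip: inv_x)
    also have "(x_xy + k) * (w + k) + y_xy = (x_xy + y_xy + k) * (x_xy + 1 + k)"
      by (simp add: w_def algebra_simps)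
    finally have "xy.cell_factor u v t c = (x_xy + k) * (w + k) / ((x_xy + y_xy + k) * (x_xy + 1 + k))"
      unfolding xy.cell_factor_def k_def[symmetric] num using w x0 by simp
    then show ?thesis unfolding k_def[symmetric] w_def by simp
  qed
  have L: "L = (\<Prod>(i, j)\<in>diagram lam. xy.cell_factor u v t (content \<alpha> i j))"
    unfolding L_def rising_def factor by (simp add: case_prod_beta prod.distrib prod_dividef)
  have "L \<in> poly_coeff_series"
  proof -
    have "xy.cell_factor u v t c \<in> poly_coeff_series" for c
    proof -
      define k where "k = const_xy c"
      have k: "k \<in> poly_coeff_series" unfolding k_def by (intro closed)
      have quot: "(x_xy + f) / (x_xy + g) \<in> poly_coeff_series"
        if f: "f \<in> poly_coeff_series" and g: "g \<in> poly_coeff_series" for f g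
      proof -
        have "x_xy + h = (1 + h * X) * x_xy" for h using Xx by (simp add: algebra_simps)
        then have "(x_xy + f) / (x_xy + g) = (1 + f * X) * inverse (1 + g * X)"
          using x0 by (metis divide_inverse mult_divide_mult_cancel_right)
        then show ?thesis using unit(1)[OF f] unit(3)[OF g] by (simp add: closed)
      qed
      show ?thesis
        unfolding factor k_def[symmetric] add.assoc by (intro poly_coeff_mult quot closed k)
    qed
    then show ?thesis unfolding L by (intro closed) auto
  qed
  moreover have "A n \<in> poly_coeff_series" for n
    unfolding A by (intro closed uvpc)
  moreover have "range (B n) \<subseteq> poly_coeff_series" for n
    unfolding B by (auto intro!: closed uvpc)
  moreover have "B n summable_on UNIV" for n
    unfolding B by (rule xy.cell_product_expansion(1)[OF u v t])
  moreover have "((\<lambda>n. A n * infsum (B n) UNIV) has_sum L) UNIV"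
    unfolding A B L by (rule xy.cell_product_expansion(2)[OF u v t])
  ultimately show ?thesis by blast
qed

end
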